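(* Let $J\neq F_n^\infty$ be a WOT-closed two-sided ideal of $F_n^\infty$, let $B_1,\ldots,B_n$ and $W_1,\ldots,W_n$ be the corresponding constrained left and right creation operators on $\mathcal N_J$, and let $\mathcal K$ be a Hilbert space. A (closed) subspace $\mathcal M\subseteq \mathcal N_J\otimes\mathcal K$ is invariant under each operator $B_i\otimes I_{\mathcal K}$, $i=1,\ldots,n$, if and only if there exist a Hilbert space $\mathcal G$ and an inner operator $$\Theta(W_1,\ldots,W_n)\in \mathcal W(W_1,\ldots,W_n)\,\bar\otimes\, B(\mathcal G,\mathcal K)$$ such that $$\mathcal M=\Theta(W_1,\ldots,W_n)\left(\mathcal N_J\otimes\mathcal G\right).$$
   Context: Let $n\in\{1,2,\dots\}$ and let $F^2(H_n)=\bigoplus_{k\ge 0}H_n^{\otimes k}$ be the full Fock space of an $n$-dimensional complex Hilbert space $H_n$ with orthonormal basis $e_1,\dots,e_n$ (with $H_n^{\otimes 0}=\mathbb C1$). The left and right creation operators are $S_i\varphi=e_i\otimes\varphi$ and $R_i\varphi=\varphi\otimes e_i$. The noncommutative analytic Toeplitz algebra $F_n^\infty\subset B(F^2(H_n))$ is the WOT-closed (equivalently $w^*$-closed) algebra generated by $S_1,\dots,S_n$ and the identity. For a WOT-closed two-sided ideal $J$ of $F_n^\infty$, put $\mathcal M_J=\overline{JF^2(H_n)}$, $\mathcal N_J=F^2(H_n)\ominus\mathcal M_J$, $B_i=P_{\mathcal N_J}S_i|_{\mathcal N_J}$ (constrained left creation operators) and $W_i=P_{\mathcal N_J}R_i|_{\mathcal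 N_J}$ (constrained right creation operators). $\mathcal W(W_1,\ldots,W_n)$ is the $w^*$-closed algebra generated by $W_1,\dots,W_n$ and the identity, and $\mathcal W(W_1,\ldots,W_n)\bar\otimes B(\mathcal G,\mathcal K)$ is the WOT-closed operator space generated by the spatial tensor product; it coincides with the set of all multi-analytic operators with respect to $B_1,\dots,B_n$, i.e. bounded operators $M:\mathcal N_J\otimes\mathcal G\to\mathcal N_J\otimes\mathcal K$ with $M(B_i\otimes I_{\mathcal G})=(B_i\otimes I_{\mathcal K})M$ for $i=1,\dots,n$. Such an operator is called inner if it is a partial isometry. *)

theory Defs
  imports "HOL-Analysis.Analysis"
begin

section \<open>Complex Hilbert spaces\<close>

text \<open>The real inner product, norm and metric of the library are those induced by the complex
  inner product, which is linear in the second argument. No separability is assumed.\<close>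

class chilbert_space = real_inner + complete_space +
  fixes scaleC :: "complex \<Rightarrow> 'a \<Rightarrow> 'a"  (infixr "*\<^sub>C" 75)
    and cinner :: "'a \<Rightarrow> 'a \<Rightarrow> complex"
  assumes scaleC_add_right: "a *\<^sub>C (x + y) = a *\<^sub>C x + a *\<^sub>C y"
    and scaleC_add_left: "(a + b) *\<^sub>C x = a *\<^sub>C x + b *\<^sub>C x"
    and scaleC_scaleC: "a *\<^sub>C (b *\<^sub>C x) = (a * b) *\<^sub>C x"
    and scaleR_scaleC: "r *\<^sub>R x = complex_of_real r *\<^sub>C x"
    and cinner_commute: "cinner x y = cnj (cinner y x)"
    and cinner_add_right: "cinner x (y + z) = cinner x y + cinner x z"
    and cinner_scaleC_right: "cinner x (a *\<^sub>C y) = a * cinner x y"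
    and inner_eq_Re_cinner: "inner x y = Re (cinner x y)"

instantiation complex :: chilbert_space
begin

definition scaleC_complex_def: "scaleC (a::complex) (x::complex) = a * x"

definition cinner_complex_def: "cinner (x::complex) (y::complex) = cnj x * y"

instance
  by standard (simp_all add: scaleC_complex_def cinner_complex_def algebra_simps
      inner_complex_def scaleR_conv_of_real)

end

lemma cinner_add_left: "cinner (x + y) z = cinner x z + cinner y (z::'a::chilbert_space)"
  by (metis cinner_add_right cinner_commute complex_cnj_add)

lemma cinner_scaleC_left: "cinner (a *\<^sub>C x) y = cnj a * cinner x (y::'a::chilbert_space)"
  by (metis cinner_commute cinner_scaleC_right complex_cnj_mult)

lemma cinner_self: "cinner x x = complex_of_real ((norm x)\<^sup>2)" for x :: "'a::chilbert_space"
proof (rule complex_eqI)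
  show "Re (cinner x x) = Re (complex_of_real ((norm x)\<^sup>2))"
    by (simp flip: inner_eq_Re_cinner add: power2_norm_eq_inner)
  have "Im (cinner x x) = - Im (cinner x x)"
    using arg_cong[OF cinner_commute[of x x], of Im] by simp
  then show "Im (cinner x x) = Im (complex_of_real ((norm x)\<^sup>2))"
    by simp
qed

lemma norm_scaleC: "norm (a *\<^sub>C x) = cmod a * norm (x::'a::chilbert_space)"
proof -
  have "complex_of_real ((norm (a *\<^sub>C x))\<^sup>2) = complex_of_real ((cmod a * norm x)\<^sup>2)"
    unfolding cinner_self[symmetric] cinner_scaleC_left cinner_scaleC_right
    by (simp add: cinner_self power_mult_distrib complex_norm_square[symmetric])
  then have "(norm (a *\<^sub>C x))\<^sup>2 = (cmod a * norm x)\<^sup>2"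
    using of_real_eq_iff by blast
  then show ?thesis
    by (simp add: power2_eq_iff_nonneg)
qed

lemma norm_cinner_le: "cmod (cinner x y) \<le> norm x * norm (y::'a::chilbert_space)"
proof (cases "cinner x y = 0")
  case False
  define u where "u = cnj (cinner x y) / complex_of_real (cmod (cinner x y))"
  have u: "cmod u = 1"
    using False by (simp add: u_def norm_divide)
  have "cinner x (u *\<^sub>C y) = complex_of_real (cmod (cinner x y))"
    using False by (simp add: cinner_scaleC_right u_def complex_norm_square[symmetric]
        power2_eq_square mult.commute)
  then have "cmod (cinner x y) = inner x (u *\<^sub>C y)"
    by (simp add: inner_eq_Re_cinner)
  also have "\<dots> \<le> norm x * norm (u *\<^sub>C y)"
    by (rule norm_cauchy_schwarz)
  finally show ?thesis
    by (simp add: norm_scaleC u)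
qed auto


section \<open>Hilbert space direct sums of copies of a Hilbert space\<close>

definition square_summable :: "('a \<Rightarrow> 'k::chilbert_space) \<Rightarrow> bool" where
  "square_summable f \<longleftrightarrow> (\<lambda>i. (norm (f i))\<^sup>2) summable_on UNIV"

lemma square_summable_zero: "square_summable (\<lambda>_. 0)"
  by (simp add: square_summable_def)

lemma square_summable_add:
  assumes "square_summable f" "square_summable g"
  shows "square_summable (\<lambda>i. f i + g i)"
  unfolding square_summable_def
proof (rule summable_on_comparison_test)
  show "(\<lambda>i. 2 * (norm (f i))\<^sup>2 + 2 * (norm (g i))\<^sup>2) summable_on UNIV"
    using assms unfolding square_summable_def
    by (intro summable_on_add summable_on_cmult_right) auto
  fix i
  have "(norm (f i + g i))\<^sup>2 \<le> (norm (f i) + norm (g i))\<^sup>2"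
    by (intro power_mono norm_triangle_ineq) auto
  also have "\<dots> \<le> 2 * (norm (f i))\<^sup>2 + 2 * (norm (g i))\<^sup>2"
    using sum_squares_bound[of "norm (f i)" "norm (g i)"]
    by (simp add: power2_sum)
  finally show "(norm (f i + g i))\<^sup>2 \<le> 2 * (norm (f i))\<^sup>2 + 2 * (norm (g i))\<^sup>2" .
qed auto

lemma square_summable_scaleC:
  "square_summable f \<Longrightarrow> square_summable (\<lambda>i. c *\<^sub>C f i)"
  unfolding square_summable_def norm_scaleC power_mult_distrib
  by (rule summable_on_cmult_right)

lemma square_summable_scaleR:
  "square_summable f \<Longrightarrow> square_summable (\<lambda>i. r *\<^sub>R f i)"
  by (simp add: scaleR_scaleC square_summable_scaleC)

lemma square_summable_uminus:
  "square_summable f \<Longrightarrow> square_summable (\<lambda>i. - f i)"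
  by (simp add: square_summable_def)

lemma square_summable_diff:
  "square_summable f \<Longrightarrow> square_summable g \<Longrightarrow> square_summable (\<lambda>i. f i - g i)"
  using square_summable_add[OF _ square_summable_uminus, of f g] by simp

lemma cinner_summable:
  assumes "square_summable f" "square_summable g"
  shows "(\<lambda>i. cinner (f i) (g i)) summable_on UNIV"
proof -
  have "(\<lambda>i. norm (cinner (f i) (g i))) summable_on UNIV"
  proof (rule summable_on_comparison_test)
    show "(\<lambda>i. (norm (f i))\<^sup>2 + (norm (g i))\<^sup>2) summable_on UNIV"
      using assms unfolding square_summable_def by (rule summable_on_add)
    fix i
    have "cmod (cinner (f i) (g i)) \<le> norm (f i) * norm (g i)"
      by (rule norm_cinner_le)
    also have "\<dots> \<le> (norm (f i))\<^sup>2 + (norm (g i))\<^sup>2"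
      using sum_squares_bound[of "norm (f i)" "norm (g i)"]
        mult_nonneg_nonneg[of "norm (f i)" "norm (g i)"] norm_ge_zero[of "f i"] norm_ge_zero[of "g i"]
      by linarith
    finally show "cmod (cinner (f i) (g i)) \<le> (norm (f i))\<^sup>2 + (norm (g i))\<^sup>2" .
  qed auto
  then show ?thesis
    by (rule abs_summable_summable)
qed

text \<open>\<open>('a, 'k) ell2\<close> is the Hilbert space direct sum of copies of \<open>'k\<close> indexed by \<open>'a\<close>.
  The Hilbert space tensor product of \<open>('a, complex) ell2\<close> with \<open>'k\<close> is realised
  as \<open>('a, 'k) ell2\<close>, see \<open>elementary_tensor\<close> below.\<close>

typedef (overloaded) ('a, 'k) ell2 = "{f :: 'a \<Rightarrow> 'k::chilbert_space. square_summable f}"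
  morphisms ell2_nth Abs_ell2
  using square_summable_zero by blast

setup_lifting type_definition_ell2

lemma square_summable_ell2_nth: "square_summable (ell2_nth x)"
  using ell2_nth by blast

lemma ell2_eqI: "(\<And>i. ell2_nth x i = ell2_nth y i) \<Longrightarrow> x = y"
  by (simp add: ell2_nth_inject[symmetric] fun_eq_iff)

instantiation ell2 :: (type, chilbert_space) real_vector
begin

lift_definition zero_ell2 :: "('a, 'b) ell2" is "\<lambda>_. 0"
  by (rule square_summable_zero)

lift_definition plus_ell2 :: "('a, 'b) ell2 \<Rightarrow> ('a, 'b) ell2 \<Rightarrow> ('a, 'b) ell2"
  is "\<lambda>f g i. f i + g i"
  by (rule square_summable_add)

lift_definition minus_ell2 :: "('a, 'b) ell2 \<Rightarrow> ('a, 'b) ell2 \<Rightarrow> ('a, 'b) ell2"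
  is "\<lambda>f g i. f i - g i"
  by (rule square_summable_diff)

lift_definition uminus_ell2 :: "('a, 'b) ell2 \<Rightarrow> ('a, 'b) ell2" is "\<lambda>f i. - f i"
  by (rule square_summable_uminus)

lift_definition scaleR_ell2 :: "real \<Rightarrow> ('a, 'b) ell2 \<Rightarrow> ('a, 'b) ell2" is "\<lambda>r f i. r *\<^sub>R f i"
  by (rule square_summable_scaleR)

instance
  by (standard; transfer; simp add: algebra_simps)

end

instantiation ell2 :: (type, chilbert_space) real_inner
begin

definition inner_ell2 :: "('a, 'b) ell2 \<Rightarrow> ('a, 'b) ell2 \<Rightarrow> real" where
  "inner_ell2 x y = (\<Sum>\<^sub>\<infinity>i. inner (ell2_nth x i) (ell2_nth y i))"

definition norm_ell2 :: "('a, 'b) ell2 \<Rightarrow> real" where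
  "norm_ell2 x = sqrt (inner x x)"

definition dist_ell2 :: "('a, 'b) ell2 \<Rightarrow> ('a, 'b) ell2 \<Rightarrow> real" where
  "dist_ell2 x y = norm (x - y)"

definition sgn_ell2 :: "('a, 'b) ell2 \<Rightarrow> ('a, 'b) ell2" where
  "sgn_ell2 x = x /\<^sub>R norm x"

definition uniformity_ell2 :: "(('a, 'b) ell2 \<times> ('a, 'b) ell2) filter" where
  "uniformity_ell2 = (INF e\<in>{0<..}. principal {(x, y). dist x y < e})"

definition open_ell2 :: "('a, 'b) ell2 set \<Rightarrow> bool" where
  "open_ell2 U \<longleftrightarrow> (\<forall>x\<in>U. eventually (\<lambda>(x', y). x' = x \<longrightarrow> y \<in> U) uniformity)"

lemma inner_ell2_summable:
  "(\<lambda>i. inner (ell2_nth x i) (ell2_nth (y :: ('a, 'b) ell2) i)) summable_on UNIV"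
  unfolding inner_eq_Re_cinner
  by (intro summable_on_Re cinner_summable square_summable_ell2_nth)

instance
proof
  fix x y z :: "('a, 'b) ell2" and r :: real
  show "dist x y = norm (x - y)"
    by (rule dist_ell2_def)
  show "sgn x = x /\<^sub>R norm x"
    by (rule sgn_ell2_def)
  show "uniformity = (INF e\<in>{0<..}. principal {(x :: ('a, 'b) ell2, y). dist x y < e})"
    by (rule uniformity_ell2_def)
  show "open U \<longleftrightarrow> (\<forall>x\<in>U. eventually (\<lambda>(x', y). x' = x \<longrightarrow> y \<in> U) uniformity)"
    for U :: "('a, 'b) ell2 set"
    by (rule open_ell2_def)
  show "inner x y = inner y x"
    by (simp add: inner_ell2_def inner_commute)
  show "inner (x + y) z = inner x z + inner y z"
    unfolding inner_ell2_def plus_ell2.rep_eq inner_add_left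
    by (intro infsum_add inner_ell2_summable)
  show "inner (r *\<^sub>R x) y = r * inner x y"
    unfolding inner_ell2_def scaleR_ell2.rep_eq inner_scaleR_left
    by (intro infsum_cmult_right inner_ell2_summable)
  show "0 \<le> inner x x"
    unfolding inner_ell2_def by (intro infsum_nonneg) auto
  show "inner x x = 0 \<longleftrightarrow> x = 0"
  proof
    assume "inner x x = 0"
    then have "inner (ell2_nth x i) (ell2_nth x i) = 0" for i
      using nonneg_infsum_le_0D[OF _ inner_ell2_summable, of x x i]
      by (simp add: inner_ell2_def)
    then show "x = 0"
      by (intro ell2_eqI) (simp add: zero_ell2.rep_eq)
  next
    assume "x = 0"
    then show "inner x x = 0"
      by (simp add: inner_ell2_def zero_ell2.rep_eq)
  qed
  show "norm x = sqrt (inner x x)"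
    by (rule norm_ell2_def)
qed

end

lemma norm_ell2_sq: "(norm x)\<^sup>2 = (\<Sum>\<^sub>\<infinity>i. (norm (ell2_nth x i))\<^sup>2)"
  by (simp add: power2_norm_eq_inner inner_ell2_def)

lemma sum_norm_ell2_nth_le:
  assumes "finite F"
  shows "(\<Sum>i\<in>F. (norm (ell2_nth x i))\<^sup>2) \<le> (norm x)\<^sup>2"
  unfolding norm_ell2_sq
  using square_summable_ell2_nth[of x] assms unfolding square_summable_def
  by (intro finite_sum_le_infsum) auto

lemma norm_ell2_nth_le: "norm (ell2_nth x i) \<le> norm x"
  using sum_norm_ell2_nth_le[of "{i}" x] by (simp add: power2_le_iff_abs_le)

lemma norm_ell2_leI:
  assumes "\<And>F. finite F \<Longrightarrow> (\<Sum>i\<in>F. (norm (ell2_nth x i))\<^sup>2) \<le> c\<^sup>2" and "0 \<le> c"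
  shows "norm x \<le> c"
proof (rule power2_le_imp_le)
  show "(norm x)\<^sup>2 \<le> c\<^sup>2"
    unfolding norm_ell2_sq
    using square_summable_ell2_nth[of x] assms unfolding square_summable_def
    by (intro infsum_le_finite_sums) auto
qed fact

instance ell2 :: (type, chilbert_space) complete_space
proof
  fix X :: "nat \<Rightarrow> ('a, 'b) ell2"
  assume X: "Cauchy X"
  have "Cauchy (\<lambda>n. ell2_nth (X n) i)" for i
    unfolding Cauchy_def
  proof safe
    fix e :: real assume "e > 0"
    then obtain N where N: "\<And>m n. m \<ge> N \<Longrightarrow> n \<ge> N \<Longrightarrow> dist (X m) (X n) < e"
      using X unfolding Cauchy_def by blast
    have "dist (ell2_nth (X m) i) (ell2_nth (X n) i) \<le> dist (X m) (X n)" for m n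
      using norm_ell2_nth_le[of "X m - X n" i] by (simp add: dist_norm minus_ell2.rep_eq)
    then show "\<exists>N. \<forall>m\<ge>N. \<forall>n\<ge>N. dist (ell2_nth (X m) i) (ell2_nth (X n) i) < e"
      using N order_le_less_trans by blast
  qed
  then have "\<forall>i. \<exists>l. (\<lambda>n. ell2_nth (X n) i) \<longlonglongrightarrow> l"
    using Cauchy_convergent convergent_def by blast
  then obtain l where l: "\<And>i. (\<lambda>n. ell2_nth (X n) i) \<longlonglongrightarrow> l i"
    by metis
  have bound: "(\<Sum>i\<in>F. (norm (ell2_nth (X m) i - l i))\<^sup>2) \<le> e\<^sup>2"
    if N: "\<And>m n. m \<ge> N \<Longrightarrow> n \<ge> N \<Longrightarrow> dist (X m) (X n) < e" and m: "m \<ge> N" and F: "finite F"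
    for e N m F
  proof (rule LIMSEQ_le_const2)
    show "(\<lambda>n. \<Sum>i\<in>F. (norm (ell2_nth (X m) i - ell2_nth (X n) i))\<^sup>2)
        \<longlonglongrightarrow> (\<Sum>i\<in>F. (norm (ell2_nth (X m) i - l i))\<^sup>2)"
      by (intro tendsto_intros l)
    have "(\<Sum>i\<in>F. (norm (ell2_nth (X m) i - ell2_nth (X n) i))\<^sup>2) \<le> e\<^sup>2" if "n \<ge> N" for n
    proof -
      have "(\<Sum>i\<in>F. (norm (ell2_nth (X m) i - ell2_nth (X n) i))\<^sup>2) \<le> (norm (X m - X n))\<^sup>2"
        using sum_norm_ell2_nth_le[OF F, of "X m - X n"] by (simp add: minus_ell2.rep_eq)
      also have "\<dots> \<le> e\<^sup>2"
        using N[OF m that] by (intro power_mono) (auto simp: dist_norm)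
      finally show ?thesis .
    qed
    then show "\<exists>N. \<forall>n\<ge>N. (\<Sum>i\<in>F. (norm (ell2_nth (X m) i - ell2_nth (X n) i))\<^sup>2) \<le> e\<^sup>2"
      by blast
  qed
  obtain N1 where N1: "\<And>m n. m \<ge> N1 \<Longrightarrow> n \<ge> N1 \<Longrightarrow> dist (X m) (X n) < 1"
    using X unfolding Cauchy_def by (meson zero_less_one)
  have "square_summable (\<lambda>i. ell2_nth (X N1) i - l i)"
    unfolding square_summable_def
    using bound[OF N1 order_refl]
    by (intro nonneg_bdd_above_summable_on) (auto simp: bdd_above_def)
  then have "square_summable l"
    using square_summable_diff[OF square_summable_ell2_nth[of "X N1"]] by fastforce
  then have nth_L: "ell2_nth (Abs_ell2 l) = l"
    by (simp add: Abs_ell2_inverse)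
  have "X \<longlonglongrightarrow> Abs_ell2 l"
  proof (rule metric_LIMSEQ_I)
    fix e :: real assume "e > 0"
    then have e2: "e / 2 > 0"
      by simp
    then obtain N where N: "\<And>m n. m \<ge> N \<Longrightarrow> n \<ge> N \<Longrightarrow> dist (X m) (X n) < e / 2"
      using X unfolding Cauchy_def by blast
    have "dist (X m) (Abs_ell2 l) < e" if "m \<ge> N" for m
    proof -
      have "norm (X m - Abs_ell2 l) \<le> e / 2"
        using bound[OF N that] e2
        by (intro norm_ell2_leI) (auto simp: minus_ell2.rep_eq nth_L)
      then show ?thesis
        using \<open>e > 0\<close> by (simp add: dist_norm)
    qed
    then show "\<exists>N. \<forall>n\<ge>N. dist (X n) (Abs_ell2 l) < e"
      by blast
  qed
  then show "convergent X"
    by (auto simp: convergent_def)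
qed

instantiation ell2 :: (type, chilbert_space) chilbert_space
begin

lift_definition scaleC_ell2 :: "complex \<Rightarrow> ('a, 'b) ell2 \<Rightarrow> ('a, 'b) ell2" is "\<lambda>c f i. c *\<^sub>C f i"
  by (rule square_summable_scaleC)

definition cinner_ell2 :: "('a, 'b) ell2 \<Rightarrow> ('a, 'b) ell2 \<Rightarrow> complex" where
  "cinner_ell2 x y = (\<Sum>\<^sub>\<infinity>i. cinner (ell2_nth x i) (ell2_nth y i))"

instance
proof
  fix x y z :: "('a, 'b) ell2" and a b :: complex and r :: real
  show "a *\<^sub>C (x + y) = a *\<^sub>C x + a *\<^sub>C y" "(a + b) *\<^sub>C x = a *\<^sub>C x + b *\<^sub>C x"
    "a *\<^sub>C b *\<^sub>C x = (a * b) *\<^sub>C x" "r *\<^sub>R x = complex_of_real r *\<^sub>C x"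
    by (transfer; simp add: scaleC_add_right scaleC_add_left scaleC_scaleC scaleR_scaleC)+
  show "cinner x y = cnj (cinner y x)"
    unfolding cinner_ell2_def infsum_cnj[symmetric] by (simp flip: cinner_commute)
  show "cinner x (y + z) = cinner x y + cinner x z"
    unfolding cinner_ell2_def plus_ell2.rep_eq cinner_add_right
    by (intro infsum_add cinner_summable square_summable_ell2_nth)
  show "cinner x (a *\<^sub>C y) = a * cinner x y"
    unfolding cinner_ell2_def scaleC_ell2.rep_eq cinner_scaleC_right
    by (intro infsum_cmult_right cinner_summable square_summable_ell2_nth)
  show "inner x y = Re (cinner x y)"
    unfolding cinner_ell2_def inner_ell2_def inner_eq_Re_cinner
    by (intro infsum_Re cinner_summable square_summable_ell2_nth)
qed

end


section \<open>Subspaces and operators\<close>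

definition closed_csubspace :: "'a::chilbert_space set \<Rightarrow> bool" where
  "closed_csubspace H \<longleftrightarrow> 0 \<in> H \<and> (\<forall>x\<in>H. \<forall>y\<in>H. x + y \<in> H) \<and>
     (\<forall>c. \<forall>x\<in>H. c *\<^sub>C x \<in> H) \<and> closed H"

definition closed_cspan :: "'a::chilbert_space set \<Rightarrow> 'a set" where
  "closed_cspan X = closed_csubspace hull X"

definition orth_compl :: "'a::chilbert_space set \<Rightarrow> 'a set" where
  "orth_compl X = {x. \<forall>y\<in>X. cinner y x = 0}"

definition proj :: "'a::chilbert_space set \<Rightarrow> 'a \<Rightarrow> 'a" where
  "proj H x = (THE y. y \<in> H \<and> x - y \<in> orth_compl H)"

definition bounded_clinear :: "('a::chilbert_space \<Rightarrow> 'b::chilbert_space) \<Rightarrow> bool" where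
  "bounded_clinear T \<longleftrightarrow> bounded_linear T \<and> (\<forall>c x. T (c *\<^sub>C x) = c *\<^sub>C T x)"

text \<open>\<open>bops H K\<close> is $B(H,K)$ for closed subspaces \<open>H\<close>, \<open>K\<close> of the ambient spaces \<open>'a\<close>, \<open>'b\<close>:
  an operator from \<open>H\<close> to \<open>K\<close> is identified with its extension to \<open>'a\<close> that vanishes on the
  orthogonal complement of \<open>H\<close>. In particular the identity operator of \<open>H\<close> is \<open>proj H\<close>, and the
  compression of \<open>T\<close> to \<open>H\<close> is \<open>proj H \<circ> T \<circ> proj H\<close>. For \<open>H = UNIV\<close> nothing is extended.\<close>

definition bops :: "'a::chilbert_space set \<Rightarrow> 'b::chilbert_space set \<Rightarrow> ('a \<Rightarrow> 'b) set" where
  "bops H K = {T. bounded_clinear T \<and> range T \<subseteq> K \<and> (\<forall>x\<in>orth_compl H. T x = 0)}"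

definition compression :: "'a::chilbert_space set \<Rightarrow> ('a \<Rightarrow> 'a) \<Rightarrow> 'a \<Rightarrow> 'a" where
  "compression H T = proj H \<circ> T \<circ> proj H"

text \<open>The kernel of the extension is the direct sum of the kernel of the operator and
  \<open>orth_compl H\<close>, so its complement is the initial space of the original operator.\<close>

definition partial_isometry :: "('a::chilbert_space \<Rightarrow> 'b::chilbert_space) \<Rightarrow> bool" where
  "partial_isometry T \<longleftrightarrow> (\<forall>x\<in>orth_compl {x. T x = 0}. norm (T x) = norm x)"

text \<open>The weak operator topology on $B(H,K)$: the coarsest topology making all
  $T \mapsto \langle y, T x\rangle$ continuous (functions into \<open>complex\<close> carry the product topology).\<close>

definition wot :: "'a::chilbert_space set \<Rightarrow> 'b::chilbert_space set \<Rightarrow> ('a \<Rightarrow> 'b) topology" where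
  "wot H K = pullback_topology (bops H K) (\<lambda>T (x, y). cinner y (T x)) euclidean"

text \<open>The $w^*$-topology (ultraweak topology) on $B(H,K)$: the coarsest topology making all
  $T \mapsto \sum_k \langle y_k, T x_k\rangle$ with $(x_k)$, $(y_k)$ square summable continuous;
  these functionals are exactly those of the predual, the trace class operators.\<close>

definition weak_star :: "'a::chilbert_space set \<Rightarrow> 'b::chilbert_space set \<Rightarrow> ('a \<Rightarrow> 'b) topology"
  where
  "weak_star H K = pullback_topology (bops H K)
     (\<lambda>T (x :: (nat, 'a) ell2, y :: (nat, 'b) ell2). \<Sum>\<^sub>\<infinity>k. cinner (ell2_nth y k) (T (ell2_nth x k)))
     euclidean"

definition op_subspace :: "('a::chilbert_space \<Rightarrow> 'b::chilbert_space) set \<Rightarrow> bool" where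
  "op_subspace \<A> \<longleftrightarrow> (\<lambda>_. 0) \<in> \<A> \<and> (\<forall>A\<in>\<A>. \<forall>B\<in>\<A>. (\<lambda>x. A x + B x) \<in> \<A>) \<and>
     (\<forall>c. \<forall>A\<in>\<A>. (\<lambda>x. c *\<^sub>C A x) \<in> \<A>)"

definition op_algebra :: "('a::chilbert_space \<Rightarrow> 'a) set \<Rightarrow> bool" where
  "op_algebra \<A> \<longleftrightarrow> op_subspace \<A> \<and> (\<forall>A\<in>\<A>. \<forall>B\<in>\<A>. A \<circ> B \<in> \<A>)"


section \<open>Tensor products\<close>

text \<open>\<open>elementary_tensor \<phi> k\<close> is $\varphi\otimes k$; its inner products are
  $\langle\varphi,\psi\rangle\langle k,l\rangle$ and its closed linear span is \<open>('a, 'k) ell2\<close>.\<close>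

lift_definition elementary_tensor ::
    "('a, complex) ell2 \<Rightarrow> 'k \<Rightarrow> ('a, 'k::chilbert_space) ell2"
  is "\<lambda>\<phi> k i. \<phi> i *\<^sub>C k"
  unfolding square_summable_def norm_scaleC power_mult_distrib
  by (rule summable_on_cmult_left)

definition tensor_space ::
    "('a, complex) ell2 set \<Rightarrow> 'k set \<Rightarrow> ('a, 'k::chilbert_space) ell2 set" where
  "tensor_space H K = closed_cspan {elementary_tensor \<phi> k | \<phi> k. \<phi> \<in> H \<and> k \<in> K}"

text \<open>$A\otimes T$, the unique bounded operator mapping $\varphi\otimes g$ to
  $A\varphi\otimes Tg$; it exists for all bounded \<open>A\<close> and \<open>T\<close>.\<close>

definition tensor_op ::
    "(('a, complex) ell2 \<Rightarrow> ('b, complex) ell2) \<Rightarrow> ('g \<Rightarrow> 'k) \<Rightarrow>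
     ('a, 'g::chilbert_space) ell2 \<Rightarrow> ('b, 'k::chilbert_space) ell2" where
  "tensor_op A T = (THE X. bounded_clinear X \<and>
     (\<forall>\<phi> g. X (elementary_tensor \<phi> g) = elementary_tensor (A \<phi>) (T g)))"


section \<open>The full Fock space and the noncommutative analytic Toeplitz algebra\<close>

text \<open>The full Fock space over a Hilbert space with orthonormal basis $e_i$, \<open>i::'n\<close>, so that
  $n =$ \<open>CARD('n)\<close>. The coordinate of a vector at the word $i_1\cdots i_k$ is its coefficient
  with respect to $e_{i_1}\otimes\cdots\otimes e_{i_k}$; the empty word corresponds to the
  vacuum vector.\<close>

type_synonym 'n fock = "('n list, complex) ell2"

lemma square_summable_extend:
  assumes "square_summable f" "inj h"
    and "\<And>v. g (h v) = f v" "\<And>w. w \<notin> range h \<Longrightarrow> g w = 0"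
  shows "square_summable g"
proof -
  have "(\<lambda>w. (norm (g w))\<^sup>2) summable_on range h"
    using assms by (subst summable_on_reindex) (auto simp: o_def square_summable_def)
  then show ?thesis
    unfolding square_summable_def
    by (rule summable_on_cong_neutral[THEN iffD1, rotated -1]) (use assms(4) in auto)
qed

text \<open>$\varphi\mapsto e_i\otimes\varphi$ and $\varphi\mapsto\varphi\otimes e_i$\<close>

lift_definition left_creation :: "'n \<Rightarrow> 'n fock \<Rightarrow> 'n fock"
  is "\<lambda>i \<phi> w. if w \<noteq> [] \<and> hd w = i then \<phi> (tl w) else 0"
  subgoal for i \<phi>
    by (rule square_summable_extend[of \<phi> "\<lambda>v. i # v"])
       (auto simp: inj_on_def image_def neq_Nil_conv)
  done

lift_definition right_creation :: "'n \<Rightarrow> 'n fock \<Rightarrow> 'n fock"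
  is "\<lambda>i \<phi> w. if w \<noteq> [] \<and> last w = i then \<phi> (butlast w) else 0"
  subgoal for i \<phi>
    by (rule square_summable_extend[of \<phi> "\<lambda>v. v @ [i]"])
       (auto simp: inj_on_def image_def, metis append_butlast_last_id)
  done

definition F_infty :: "('n::finite fock \<Rightarrow> 'n fock) set" where
  "F_infty = (\<lambda>\<A>. op_algebra \<A> \<and> closedin (wot UNIV UNIV) \<A>) hull (insert id (range left_creation))"

definition wot_closed_ideal :: "('n::finite fock \<Rightarrow> 'n fock) set \<Rightarrow> bool" where
  "wot_closed_ideal J \<longleftrightarrow> J \<subseteq> F_infty \<and> op_subspace J \<and>
     (\<forall>A\<in>F_infty. \<forall>C\<in>J. A \<circ> C \<in> J \<and> C \<circ> A \<in> J) \<and> closedin (wot UNIV UNIV) J"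

definition M_space :: "('n::finite fock \<Rightarrow> 'n fock) set \<Rightarrow> 'n fock set" where
  "M_space J = closed_cspan {A \<phi> | A \<phi>. A \<in> J}"

definition N_space :: "('n::finite fock \<Rightarrow> 'n fock) set \<Rightarrow> 'n fock set" where
  "N_space J = orth_compl (M_space J)"

definition constr_left :: "('n::finite fock \<Rightarrow> 'n fock) set \<Rightarrow> 'n \<Rightarrow> 'n fock \<Rightarrow> 'n fock" where
  "constr_left J i = compression (N_space J) (left_creation i)"

definition constr_right :: "('n::finite fock \<Rightarrow> 'n fock) set \<Rightarrow> 'n \<Rightarrow> 'n fock \<Rightarrow> 'n fock" where
  "constr_right J i = compression (N_space J) (right_creation i)"

definition W_alg :: "('n::finite fock \<Rightarrow> 'n fock) set \<Rightarrow> ('n fock \<Rightarrow> 'n fock) set" where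
  "W_alg J = (\<lambda>\<A>. op_algebra \<A> \<and> closedin (weak_star (N_space J) (N_space J)) \<A>)
     hull (insert (proj (N_space J)) (range (constr_right J)))"

text \<open>$\mathcal W(W_1,\dots,W_n)\mathbin{\bar\otimes}B(G,K)$, a space of operators from
  $\mathcal N_J\otimes G$ to $\mathcal N_J\otimes K$\<close>

definition W_tensor_B ::
    "('n::finite fock \<Rightarrow> 'n fock) set \<Rightarrow> 'g::chilbert_space set \<Rightarrow> 'k::chilbert_space set \<Rightarrow>
     (('n list, 'g) ell2 \<Rightarrow> ('n list, 'k) ell2) set" where
  "W_tensor_B J G K =
     (\<lambda>\<X>. op_subspace \<X> \<and> closedin (wot (tensor_space (N_space J) G) (tensor_space (N_space J) K)) \<X>)
     hull {tensor_op A T | A T. A \<in> W_alg J \<and> T \<in> bops G K}"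

definition inner_operator ::
    "('n::finite fock \<Rightarrow> 'n fock) set \<Rightarrow> 'g::chilbert_space set \<Rightarrow> 'k::chilbert_space set \<Rightarrow>
     (('n list, 'g) ell2 \<Rightarrow> ('n list, 'k) ell2) \<Rightarrow> bool" where
  "inner_operator J G K \<Theta> \<longleftrightarrow> \<Theta> \<in> W_tensor_B J G K \<and> partial_isometry \<Theta>"

end

theory Submission
  imports Defs
begin

text \<open>Let \<open>P\<close> be the projection onto $\mathcal N_J\otimes\mathcal K$. If $\mathcal M$ is invariant, then
  $\mathcal M'=\mathcal M\oplus(\mathcal M_J\otimes\mathcal K)$ is invariant under the $S_i\otimes I$, so by the
  Wold decomposition it is the range of an isometric multi-analytic operator \<open>V\<close> on
  $F^2(H_n)\otimes\mathcal G$, where $\mathcal G$ is the wandering subspace of $\mathcal M'$. Then $\Theta=PV$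
  is a partial isometry with range $\mathcal M$, because $\ker P\subseteq\mathcal M'$ is contained in the range of
  \<open>V\<close>. The Cesaro means of the Fourier series $V\sim\sum_u R_u\otimes T_u$ are contractions, hence converge
  weakly, and compressing them to $\mathcal N_J$ puts $\Theta$ into the WOT-closed span of the tensor products.
  Conversely, operators that intertwine the $B_i\otimes I$ form a WOT-closed subspace containing the
  generators of that span.\<close>

section \<open>Complex Hilbert spaces\<close>

lemma scaleC_zero_left [simp]: "0 *\<^sub>C x = (0::'a::chilbert_space)"
  using scaleR_scaleC[of 0 x] by simp

lemma scaleC_one [simp]: "1 *\<^sub>C x = (x::'a::chilbert_space)"
  using scaleR_scaleC[of 1 x] by simp

lemma scaleC_zero_right [simp]: "c *\<^sub>C 0 = (0::'a::chilbert_space)"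
  using scaleC_scaleC[of c 0 "0::'a"] by simp

lemma scaleC_minus_one [simp]: "(- 1) *\<^sub>C x = - (x::'a::chilbert_space)"
  using scaleR_scaleC[of "- 1" x] by simp

lemma scaleC_minus_right: "c *\<^sub>C (- x) = - (c *\<^sub>C (x::'a::chilbert_space))"
  using scaleC_scaleC[of c "- 1" x] scaleC_scaleC[of "- 1" c x] by simp

lemma scaleC_diff_right: "c *\<^sub>C (x - y) = c *\<^sub>C x - c *\<^sub>C (y::'a::chilbert_space)"
  using scaleC_add_right[of c x "- y"] by (simp add: scaleC_minus_right)

lemma cinner_zero_left [simp]: "cinner 0 (x::'a::chilbert_space) = 0"
  using cinner_scaleC_left[of 0 x x] by simp

lemma cinner_zero_right [simp]: "cinner (x::'a::chilbert_space) 0 = 0"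
  using cinner_scaleC_right[of x 0 x] by simp

lemma cinner_minus_right: "cinner (x::'a::chilbert_space) (- y) = - cinner x y"
  using cinner_scaleC_right[of x "- 1" y] by simp

lemma cinner_minus_left: "cinner (- x) (y::'a::chilbert_space) = - cinner x y"
  using cinner_scaleC_left[of "- 1" x y] by simp

lemma cinner_diff_right: "cinner (x::'a::chilbert_space) (y - z) = cinner x y - cinner x z"
  using cinner_add_right[of x y "- z"] by (simp add: cinner_minus_right)

lemma cinner_diff_left: "cinner (x - y) (z::'a::chilbert_space) = cinner x z - cinner y z"
  using cinner_add_left[of x "- y" z] by (simp add: cinner_minus_left)

lemma cinner_sum_right:
  "cinner (x::'a::chilbert_space) (sum f A) = (\<Sum>i\<in>A. cinner x (f i))"
  by (induction A rule: infinite_finite_induct) (auto simp: cinner_add_right)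

lemma cinner_sum_left:
  "cinner (sum f A) (x::'a::chilbert_space) = (\<Sum>i\<in>A. cinner (f i) x)"
  by (induction A rule: infinite_finite_induct) (auto simp: cinner_add_left)

lemma cinner_self_eq_0 [simp]: "cinner x x = 0 \<longleftrightarrow> (x::'a::chilbert_space) = 0"
  by (simp add: cinner_self)

lemma cinner_eq_0_commute: "cinner x y = 0 \<longleftrightarrow> cinner y (x::'a::chilbert_space) = 0"
  by (metis cinner_commute complex_cnj_zero_iff)

lemma cinner_ext: "(\<And>z. cinner z x = cinner z (y::'a::chilbert_space)) \<Longrightarrow> x = y"
  by (metis cinner_diff_right cinner_self_eq_0 diff_self right_minus_eq)

lemma bounded_linear_cinner_right: "bounded_linear (\<lambda>y. cinner (x::'a::chilbert_space) y)"
proof (rule bounded_linear_intro)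
  show "cmod (cinner x y) \<le> norm y * norm x" for y
    using norm_cinner_le[of x y] by (simp add: mult.commute)
qed (simp_all add: cinner_add_right cinner_scaleC_right scaleR_scaleC scaleC_complex_def)

subsection \<open>Bounded operators\<close>

lemma bounded_clinearI:
  assumes "\<And>x y. T (x + y) = T x + T y" and "\<And>c x. T (c *\<^sub>C x) = c *\<^sub>C T x"
    and "\<And>x. norm (T x) \<le> C * norm x"
  shows "bounded_clinear T"
  unfolding bounded_clinear_def
proof (intro conjI allI bounded_linear_intro)
  show "norm (T x) \<le> norm x * C" for x
    using assms(3)[of x] by (simp add: mult.commute)
qed (auto simp: assms(1,2) scaleR_scaleC)

lemma bounded_clinear_imp_bounded_linear: "bounded_clinear T \<Longrightarrow> bounded_linear T"
  by (simp add: bounded_clinear_def)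

lemma bounded_clinear_scaleC: "bounded_clinear T \<Longrightarrow> T (c *\<^sub>C x) = c *\<^sub>C T x"
  by (simp add: bounded_clinear_def)

lemma bounded_clinear_linear: "bounded_clinear T \<Longrightarrow> linear T"
  by (simp add: bounded_clinear_imp_bounded_linear bounded_linear.linear)

lemma bounded_clinear_id: "bounded_clinear id" "bounded_clinear (\<lambda>x. x)"
  by (auto simp: bounded_clinear_def id_def)

lemma bounded_clinear_0: "bounded_clinear (\<lambda>_. 0)"
  by (auto simp: bounded_clinear_def)

lemma bounded_clinear_compose:
  "bounded_clinear S \<Longrightarrow> bounded_clinear T \<Longrightarrow> bounded_clinear (S \<circ> T)"
  unfolding bounded_clinear_def o_def by (auto intro: bounded_linear_compose)

lemma bounded_clinear_add:
  "bounded_clinear S \<Longrightarrow> bounded_clinear T \<Longrightarrow> bounded_clinear (\<lambda>x. S x + T x)"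
  unfolding bounded_clinear_def by (auto intro: bounded_linear_add simp: scaleC_add_right)

lemma bounded_clinear_const_scaleC:
  assumes "bounded_clinear T"
  shows "bounded_clinear (\<lambda>x. c *\<^sub>C T x)"
proof -
  obtain K where K: "\<And>x. norm (T x) \<le> norm x * K"
    using assms bounded_linear.bounded unfolding bounded_clinear_def by blast
  show ?thesis
  proof (rule bounded_clinearI)
    show "norm (c *\<^sub>C T x) \<le> (cmod c * K) * norm x" for x
      using mult_left_mono[OF K[of x], of "cmod c"] by (simp add: norm_scaleC algebra_simps)
  qed (use assms in \<open>auto simp: bounded_clinear_scaleC scaleC_add_right scaleC_scaleC mult.commute
      linear_add[OF bounded_clinear_linear]\<close>)
qed

lemma bounded_clinear_sum:
  "(\<And>i. i \<in> I \<Longrightarrow> bounded_clinear (T i)) \<Longrightarrow> bounded_clinear (\<lambda>x. \<Sum>i\<in>I. T i x)"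
  by (induction I rule: infinite_finite_induct) (auto intro: bounded_clinear_0 bounded_clinear_add)

lemma bounded_clinear_if:
  "(P \<Longrightarrow> bounded_clinear T) \<Longrightarrow> bounded_clinear (\<lambda>x. if P then T x else 0)"
  by (cases P) (auto intro: bounded_clinear_0)

lemma bounded_clinear_cinner_right: "bounded_clinear (\<lambda>y. cinner (x::'a::chilbert_space) y)"
  by (simp add: bounded_clinear_def bounded_linear_cinner_right cinner_scaleC_right
      scaleC_complex_def)


subsection \<open>Closed subspaces\<close>

lemma closed_csubspace_0: "closed_csubspace H \<Longrightarrow> 0 \<in> H"
  and closed_csubspace_add: "closed_csubspace H \<Longrightarrow> x \<in> H \<Longrightarrow> y \<in> H \<Longrightarrow> x + y \<in> H"
  and closed_csubspace_scaleC: "closed_csubspace H \<Longrightarrow> x \<in> H \<Longrightarrow> c *\<^sub>C x \<in> H"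
  and closed_csubspace_closed: "closed_csubspace H \<Longrightarrow> closed H"
  by (auto simp: closed_csubspace_def)

lemma closed_csubspace_scaleR: "closed_csubspace H \<Longrightarrow> x \<in> H \<Longrightarrow> r *\<^sub>R x \<in> H"
  by (simp add: scaleR_scaleC closed_csubspace_scaleC)

lemma closed_csubspace_diff: "closed_csubspace H \<Longrightarrow> x \<in> H \<Longrightarrow> y \<in> H \<Longrightarrow> x - y \<in> H"
  using closed_csubspace_add[of H x "(- 1) *\<^sub>C y"] closed_csubspace_scaleC[of H y "- 1"] by simp

lemma closed_csubspace_sum:
  "closed_csubspace H \<Longrightarrow> (\<And>i. i \<in> I \<Longrightarrow> f i \<in> H) \<Longrightarrow> sum f I \<in> H"
  by (induction I rule: infinite_finite_induct)
    (auto intro: closed_csubspace_0 closed_csubspace_add)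

lemma closed_csubspace_UNIV: "closed_csubspace UNIV"
  by (simp add: closed_csubspace_def)

lemma closed_csubspace_Int:
  "closed_csubspace H \<Longrightarrow> closed_csubspace K \<Longrightarrow> closed_csubspace (H \<inter> K)"
  by (auto simp: closed_csubspace_def)

lemma closed_csubspace_Inter:
  "(\<And>H. H \<in> \<H> \<Longrightarrow> closed_csubspace H) \<Longrightarrow> closed_csubspace (\<Inter>\<H>)"
  by (auto simp: closed_csubspace_def)

lemma closed_csubspace_vimage:
  assumes "bounded_clinear T" "closed_csubspace H"
  shows "closed_csubspace {x. T x \<in> H}"
proof -
  have "linear T" "continuous_on UNIV T"
    using assms by (auto intro: bounded_clinear_linear linear_continuous_on
        bounded_clinear_imp_bounded_linear)
  then show ?thesis
    using assms closed_vimage[of H T]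
    by (auto simp: closed_csubspace_def linear_0 linear_add bounded_clinear_scaleC vimage_def)
qed

lemma closed_csubspace_zero: "closed_csubspace {0}"
  by (simp add: closed_csubspace_def)

lemma closed_csubspace_eq:
  assumes "bounded_clinear S" "bounded_clinear T"
  shows "closed_csubspace {x. S x = T x}"
proof -
  have "bounded_clinear (\<lambda>x. S x + (- 1) *\<^sub>C T x)"
    by (intro bounded_clinear_add bounded_clinear_const_scaleC assms)
  from closed_csubspace_vimage[OF this closed_csubspace_zero] show ?thesis
    by simp
qed

lemma closed_csubspace_closed_cspan: "closed_csubspace (closed_cspan X)"
  unfolding closed_cspan_def by (rule hull_in) (auto intro: closed_csubspace_Inter)

lemma closed_cspan_superset: "X \<subseteq> closed_cspan X"
  unfolding closed_cspan_def by (rule hull_subset)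

lemma closed_cspan_minimal: "X \<subseteq> H \<Longrightarrow> closed_csubspace H \<Longrightarrow> closed_cspan X \<subseteq> H"
  unfolding closed_cspan_def by (rule hull_minimal)

lemma closed_csubspace_orth_compl: "closed_csubspace (orth_compl X)"
proof -
  have "orth_compl X = \<Inter> ((\<lambda>y. {x. cinner y x \<in> {0}}) ` X)"
    by (auto simp: orth_compl_def)
  then show ?thesis
    using closed_csubspace_vimage[OF bounded_clinear_cinner_right closed_csubspace_zero]
    by (auto intro!: closed_csubspace_Inter)
qed


subsection \<open>Orthogonal projections\<close>

lemma closest_point_orthogonal:
  fixes x :: "'a::real_inner"
  assumes "\<And>t. norm x \<le> norm (x - t *\<^sub>R z)"
  shows "inner x z = 0"
proof (cases "z = 0")
  case False
  \<comment> \<open>This \<open>t\<close> minimises the norm of \<open>x - t *\<^sub>R z\<close>,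
    which makes the assumed inequality as strong as possible.\<close>
  define t where "t = inner x z / (norm z)\<^sup>2"
  have "(norm x)\<^sup>2 \<le> (norm (x - t *\<^sub>R z))\<^sup>2"
    using assms by (intro power_mono) auto
  also have "\<dots> = (norm x)\<^sup>2 - 2 * t * inner x z + t\<^sup>2 * (norm z)\<^sup>2"
    using dot_norm_neg[of x "t *\<^sub>R z"] by (simp add: power_mult_distrib)
  also have "\<dots> = (norm x)\<^sup>2 - (inner x z)\<^sup>2 / (norm z)\<^sup>2"
    using False by (simp add: t_def field_simps power2_eq_square)
  finally have "(inner x z)\<^sup>2 / (norm z)\<^sup>2 \<le> 0"
    by simp
  then show ?thesis
    using False by (simp add: divide_le_0_iff)
qed auto

text \<open>A minimising sequence is Cauchy by the parallelogram law for \<open>x - h m\<close> and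
  \<open>x - h n\<close>: the midpoint of \<open>h m\<close> and \<open>h n\<close> stays in
  \<open>H\<close>, so its distance from \<open>x\<close> is at least \<open>d\<close>.\<close>

lemma ex_closest_point:
  assumes "closed_csubspace H"
  shows "\<exists>y\<in>H. \<forall>z\<in>H. norm (x - y) \<le> norm (x - z)"
proof -
  define d where "d = infdist x H"
  have ne: "H \<noteq> {}"
    using closed_csubspace_0[OF assms] by auto
  have d_le: "d \<le> norm (x - z)" if "z \<in> H" for z
    using infdist_le[OF that, of x] by (simp add: d_def dist_norm)
  have d0: "0 \<le> d"
    by (simp add: d_def infdist_nonneg)
  have "\<exists>h\<in>H. (norm (x - h))\<^sup>2 < d\<^sup>2 + 1 / real (Suc n)" for n
  proof -
    have "d < sqrt (d\<^sup>2 + 1 / real (Suc n))"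
      by (rule real_less_rsqrt) auto
    then have "\<exists>r\<in>dist x ` H. r < sqrt (d\<^sup>2 + 1 / real (Suc n))"
      using ne unfolding d_def infdist_def by (intro cInf_lessD) (auto split: if_splits)
    then obtain h where h: "h \<in> H" "dist x h < sqrt (d\<^sup>2 + 1 / real (Suc n))"
      by blast
    then have "(norm (x - h))\<^sup>2 < (sqrt (d\<^sup>2 + 1 / real (Suc n)))\<^sup>2"
      by (intro power_strict_mono) (auto simp: dist_norm)
    then show ?thesis
      using h(1) by (auto simp: add_nonneg_nonneg)
  qed
  then obtain h where hH: "\<And>n. h n \<in> H" and h: "\<And>n. (norm (x - h n))\<^sup>2 < d\<^sup>2 + 1 / real (Suc n)"
    by metis
  have par: "(norm (h m - h n))\<^sup>2 \<le> 2 / real (Suc m) + 2 / real (Suc n)" for m n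
  proof -
    have "(1/2) *\<^sub>R (h m + h n) \<in> H"
      by (intro closed_csubspace_scaleR closed_csubspace_add assms hH)
    then have "d\<^sup>2 \<le> (norm (x - (1/2) *\<^sub>R (h m + h n)))\<^sup>2"
      using d_le d0 by (intro power_mono) auto
    moreover have "(norm (h m - h n))\<^sup>2 = 2 * (norm (x - h m))\<^sup>2 + 2 * (norm (x - h n))\<^sup>2
        - 4 * (norm (x - (1/2) *\<^sub>R (h m + h n)))\<^sup>2"
      by (simp add: power2_norm_eq_inner inner_diff_left inner_diff_right inner_add_left
          inner_add_right inner_commute algebra_simps)
    ultimately show ?thesis
      using h[of m] h[of n] by simp
  qed
  have "Cauchy h"
    unfolding Cauchy_def
  proof safe
    fix e :: real assume "e > 0"
    then obtain N where N: "inverse (real (Suc N)) < e\<^sup>2 / 4"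
      using reals_Archimedean[of "e\<^sup>2 / 4"] by auto
    have "dist (h m) (h n) < e" if "m \<ge> N" "n \<ge> N" for m n
    proof -
      have "1 / real (Suc m) \<le> inverse (real (Suc N))" "1 / real (Suc n) \<le> inverse (real (Suc N))"
        using that by (auto simp: field_simps)
      then have "(norm (h m - h n))\<^sup>2 < e\<^sup>2"
        using par[of m n] N by simp
      then show ?thesis
        using \<open>e > 0\<close> by (auto simp: dist_norm intro: power2_less_imp_less)
    qed
    then show "\<exists>N. \<forall>m\<ge>N. \<forall>n\<ge>N. dist (h m) (h n) < e"
      by blast
  qed
  then obtain y where y: "h \<longlonglongrightarrow> y"
    using Cauchy_convergent convergent_def by blast
  then have "y \<in> H"
    using closed_sequentially[OF closed_csubspace_closed[OF assms]] hH by blast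
  moreover have "(norm (x - y))\<^sup>2 \<le> d\<^sup>2"
  proof (rule LIMSEQ_le)
    show "(\<lambda>n. (norm (x - h n))\<^sup>2) \<longlonglongrightarrow> (norm (x - y))\<^sup>2"
      by (intro tendsto_intros y)
    show "(\<lambda>n. d\<^sup>2 + 1 / real (Suc n)) \<longlonglongrightarrow> d\<^sup>2"
      using tendsto_add[OF tendsto_const LIMSEQ_inverse_real_of_nat, of "d\<^sup>2"]
      by (simp add: inverse_eq_divide)
    show "\<exists>N. \<forall>n\<ge>N. (norm (x - h n))\<^sup>2 \<le> d\<^sup>2 + 1 / real (Suc n)"
      using h less_imp_le by blast
  qed
  then have "norm (x - y) \<le> d"
    using d0 power2_le_imp_le by blast
  ultimately show ?thesis
    using d_le order_trans by blast
qed

lemma ex_proj: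
  assumes H: "closed_csubspace H"
  shows "\<exists>y. y \<in> H \<and> x - y \<in> orth_compl H"
proof -
  obtain y where y: "y \<in> H" and le: "\<And>z. z \<in> H \<Longrightarrow> norm (x - y) \<le> norm (x - z)"
    using ex_closest_point[OF H] by blast
  have re: "Re (cinner z (x - y)) = 0" if z: "z \<in> H" for z
  proof -
    have "norm (x - y) \<le> norm (x - y - t *\<^sub>R z)" for t
      using le[OF closed_csubspace_add[OF H y closed_csubspace_scaleR[OF H z, of t]]]
      by (simp add: algebra_simps)
    then have "inner (x - y) z = 0"
      by (rule closest_point_orthogonal)
    then show ?thesis
      by (metis inner_commute inner_eq_Re_cinner)
  qed
  \<comment> \<open>Minimality controls only the real inner product; testing with
    \<open>\<i> *\<^sub>C z\<close> as well removes the imaginary part.\<close>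
  have "cinner z (x - y) = 0" if z: "z \<in> H" for z
    using re[OF z] re[OF closed_csubspace_scaleC[OF H z, of \<i>]]
    by (simp add: cinner_scaleC_left complex_eq_iff)
  then show ?thesis
    using y by (auto simp: orth_compl_def)
qed

lemma proj_eqI:
  assumes H: "closed_csubspace H" and "y \<in> H" "x - y \<in> orth_compl H"
  shows "proj H x = y"
  unfolding proj_def
proof (rule the_equality)
  show "y \<in> H \<and> x - y \<in> orth_compl H"
    using assms by simp
  fix z assume z: "z \<in> H \<and> x - z \<in> orth_compl H"
  then have "(x - y) - (x - z) \<in> orth_compl H" "z - y \<in> H"
    using assms closed_csubspace_diff closed_csubspace_orth_compl by blast+
  then have "cinner (z - y) (z - y) = 0"
    by (auto simp: orth_compl_def)
  then show "z = y"
    by simp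
qed

lemma proj_in: "closed_csubspace H \<Longrightarrow> proj H x \<in> H"
  and proj_orth: "closed_csubspace H \<Longrightarrow> x - proj H x \<in> orth_compl H"
  using ex_proj proj_eqI by metis+

lemma proj_ident: "closed_csubspace H \<Longrightarrow> x \<in> H \<Longrightarrow> proj H x = x"
  by (rule proj_eqI) (auto simp: closed_csubspace_0 closed_csubspace_orth_compl)

lemma proj_orth_compl: "closed_csubspace H \<Longrightarrow> x \<in> orth_compl H \<Longrightarrow> proj H x = 0"
  by (rule proj_eqI) (auto simp: closed_csubspace_0)

lemma cinner_proj_orth: "closed_csubspace H \<Longrightarrow> y \<in> H \<Longrightarrow> cinner y (x - proj H x) = 0"
  using proj_orth by (auto simp: orth_compl_def)

lemma cinner_proj_eq: "closed_csubspace H \<Longrightarrow> y \<in> H \<Longrightarrow> cinner y (proj H x) = cinner y x"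
  using cinner_proj_orth[of H y x] by (simp add: cinner_diff_right)

lemma proj_self_adjoint:
  assumes "closed_csubspace H"
  shows "cinner x (proj H y) = cinner (proj H x) y"
  using cinner_proj_eq[OF assms proj_in[OF assms], of y x]
    cinner_proj_eq[OF assms proj_in[OF assms], of x y] by (metis cinner_commute)

lemma norm_proj_le:
  assumes "closed_csubspace H"
  shows "norm (proj H x) \<le> norm x"
proof -
  have "(norm (proj H x))\<^sup>2 = Re (cinner (proj H x) x)"
    using cinner_proj_eq[OF assms proj_in[OF assms], of x x] by (metis Re_complex_of_real cinner_self)
  also have "\<dots> \<le> norm (proj H x) * norm x"
    using norm_cinner_le complex_Re_le_cmod order_trans by blast
  finally show ?thesis
    by (cases "proj H x = 0") (auto simp: power2_eq_square)
qed

lemma bounded_clinear_proj: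
  assumes H: "closed_csubspace H"
  shows "bounded_clinear (proj H)"
proof (rule bounded_clinearI)
  fix x y c
  show "proj H (x + y) = proj H x + proj H y"
    using closed_csubspace_add[OF closed_csubspace_orth_compl proj_orth[OF H] proj_orth[OF H], of x y]
    by (intro proj_eqI H) (auto intro: closed_csubspace_add proj_in H simp: algebra_simps)
  show "proj H (c *\<^sub>C x) = c *\<^sub>C proj H x"
    using closed_csubspace_scaleC[OF closed_csubspace_orth_compl proj_orth[OF H], of c x]
    by (intro proj_eqI H) (auto intro: closed_csubspace_scaleC proj_in H simp: scaleC_diff_right)
  show "norm (proj H x) \<le> 1 * norm x"
    by (simp add: norm_proj_le H)
qed

lemma orth_compl_orth_compl:
  assumes H: "closed_csubspace H"
  shows "orth_compl (orth_compl H) = H"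
proof
  show "H \<subseteq> orth_compl (orth_compl H)"
    by (auto simp: orth_compl_def cinner_eq_0_commute)
  show "orth_compl (orth_compl H) \<subseteq> H"
  proof
    fix x assume x: "x \<in> orth_compl (orth_compl H)"
    have "cinner (x - proj H x) x = 0" "cinner (x - proj H x) (proj H x) = 0"
      using x proj_orth[OF H, of x] proj_in[OF H, of x]
      by (auto simp: orth_compl_def cinner_eq_0_commute)
    then have "cinner (x - proj H x) (x - proj H x) = 0"
      by (simp add: cinner_diff_right)
    then show "x \<in> H"
      using proj_in[OF H, of x] by simp
  qed
qed

lemma closed_csubspace_eq_UNIV:
  assumes H: "closed_csubspace H" and "\<And>x. x \<in> orth_compl H \<Longrightarrow> x = 0"
  shows "x \<in> H"
  using assms(2)[OF proj_orth[OF H, of x]] proj_in[OF H, of x] by simp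

lemma riesz_representation:
  fixes f :: "'a::chilbert_space \<Rightarrow> complex"
  assumes f: "bounded_clinear f"
  shows "\<exists>y. \<forall>x. f x = cinner y x"
proof (cases "\<forall>x. f x = 0")
  case True
  then show ?thesis
    by (intro exI[of _ 0]) auto
next
  case False
  then obtain x0 where x0: "f x0 \<noteq> 0"
    by blast
  define H where "H = {x. f x \<in> {0}}"
  have H: "closed_csubspace H"
    unfolding H_def by (rule closed_csubspace_vimage[OF f closed_csubspace_zero])
  define z where "z = x0 - proj H x0"
  have lin: "linear f"
    using f by (rule bounded_clinear_linear)
  have "f (proj H x0) = 0"
    using proj_in[OF H, of x0] by (simp add: H_def)
  then have fz: "f z \<noteq> 0"
    using x0 by (simp add: z_def linear_diff[OF lin])
  then have nz: "norm z \<noteq> 0"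
    using linear_0[OF lin] by auto
  have "f x = cinner (cnj (f z / complex_of_real ((norm z)\<^sup>2)) *\<^sub>C z) x" for x
  proof -
    \<comment> \<open>This combination is annihilated by \<open>f\<close>, and \<open>z\<close> is
      orthogonal to the kernel; pairing the two expresses \<open>f x\<close> through
      \<open>cinner z x\<close>.\<close>
    have "f x *\<^sub>C z - f z *\<^sub>C x \<in> H"
      by (simp add: H_def linear_diff[OF lin] bounded_clinear_scaleC[OF f] scaleC_complex_def)
    then have "cinner (f x *\<^sub>C z - f z *\<^sub>C x) z = 0"
      unfolding z_def by (rule cinner_proj_orth[OF H])
    then have "cinner z (f x *\<^sub>C z - f z *\<^sub>C x) = 0"
      by (simp add: cinner_eq_0_commute)
    then have "f x * complex_of_real ((norm z)\<^sup>2) = f z * cinner z x"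
      by (simp add: cinner_diff_right cinner_scaleC_right cinner_self)
    then show ?thesis
      using nz by (simp add: cinner_scaleC_left field_simps)
  qed
  then show ?thesis
    by blast
qed

lemma ex_adjoint:
  assumes "bounded_clinear T"
  shows "\<exists>z. \<forall>x. cinner y (T x) = cinner z x"
  using riesz_representation[OF bounded_clinear_compose[OF bounded_clinear_cinner_right[of y] assms]]
  by simp


subsection \<open>Finite orthonormal sets\<close>

definition orthonormal :: "'a::chilbert_space set \<Rightarrow> bool" where
  "orthonormal U \<longleftrightarrow> (\<forall>u\<in>U. \<forall>v\<in>U. cinner u v = (if u = v then 1 else 0))"

lemma cinner_orthonormal_sum:
  assumes "finite U" "orthonormal U" "v \<in> U"
  shows "cinner v (\<Sum>u\<in>U. c u *\<^sub>C u) = c v"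
proof -
  have "cinner v (\<Sum>u\<in>U. c u *\<^sub>C u) = (\<Sum>u\<in>U. if u = v then c v else 0)"
    using assms unfolding cinner_sum_right
    by (intro sum.cong) (auto simp: orthonormal_def cinner_scaleC_right)
  then show ?thesis
    using assms by simp
qed

lemma norm_orthonormal_sum:
  assumes "finite U" "orthonormal U"
  shows "(norm (\<Sum>u\<in>U. c u *\<^sub>C u))\<^sup>2 = (\<Sum>u\<in>U. (cmod (c u))\<^sup>2)"
proof -
  have "complex_of_real ((norm (\<Sum>u\<in>U. c u *\<^sub>C u))\<^sup>2) = (\<Sum>u\<in>U. cnj (c u) * c u)"
    unfolding cinner_self[symmetric]
    by (subst cinner_sum_left) (auto intro!: sum.cong simp: cinner_scaleC_left cinner_orthonormal_sum assms)
  also have "\<dots> = complex_of_real (\<Sum>u\<in>U. (cmod (c u))\<^sup>2)"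
    unfolding of_real_sum complex_norm_square by (simp add: mult.commute)
  finally show ?thesis
    using of_real_eq_iff by blast
qed

lemma bessel_inequality:
  assumes U: "finite U" "orthonormal U"
  shows "(\<Sum>u\<in>U. (cmod (cinner u x))\<^sup>2) \<le> (norm x)\<^sup>2"
proof -
  define p where "p = (\<Sum>u\<in>U. cinner u x *\<^sub>C u)"
  have pp: "(norm p)\<^sup>2 = (\<Sum>u\<in>U. (cmod (cinner u x))\<^sup>2)"
    unfolding p_def by (rule norm_orthonormal_sum[OF U])
  have "cinner p x = (\<Sum>u\<in>U. cnj (cinner u x) * cinner u x)"
    by (simp add: p_def cinner_sum_left cinner_scaleC_left)
  also have "\<dots> = complex_of_real ((norm p)\<^sup>2)"
    unfolding pp of_real_sum complex_norm_square by (simp add: mult.commute)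
  finally have "(norm p)\<^sup>2 = Re (cinner p x)"
    by simp
  also have "\<dots> \<le> norm p * norm x"
    using norm_cinner_le complex_Re_le_cmod order_trans by blast
  finally have "norm p \<le> norm x"
    by (cases "p = 0") (auto simp: power2_eq_square)
  then show ?thesis
    unfolding pp[symmetric] by (intro power_mono) auto
qed

text \<open>Gram-Schmidt, one vector at a time. Norm estimates involve finitely many coordinates at
  once, so a basis of their span is enough in a space of any dimension.\<close>

lemma ex_finite_orthonormal_basis:
  assumes "finite X"
  shows "\<exists>U. finite U \<and> orthonormal U \<and> (\<forall>x\<in>X. x = (\<Sum>u\<in>U. cinner u x *\<^sub>C u))"
  using assms
proof (induction X)
  case empty
  show ?case
    by (intro exI[of _ "{}"]) (auto simp: orthonormal_def)
next
  case (insert x X)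
  then obtain U where U: "finite U" "orthonormal U" and X: "\<And>x. x \<in> X \<Longrightarrow> x = (\<Sum>u\<in>U. cinner u x *\<^sub>C u)"
    by blast
  define y where "y = x - (\<Sum>u\<in>U. cinner u x *\<^sub>C u)"
  show ?case
  proof (cases "y = 0")
    case True
    then show ?thesis
      using U X by (intro exI[of _ U]) (auto simp: y_def)
  next
    case False
    define v where "v = (1 / complex_of_real (norm y)) *\<^sub>C y"
    have uy: "cinner u y = 0" if "u \<in> U" for u
      using cinner_orthonormal_sum[OF U that] by (simp add: y_def cinner_diff_right)
    then have uv: "cinner u v = 0" if "u \<in> U" for u
      using that by (simp add: v_def cinner_scaleC_right)
    have "norm v = 1"
      using False by (simp add: v_def norm_scaleC norm_divide)
    then have vv: "cinner v v = 1"
      by (simp add: cinner_self)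
    have vU: "v \<notin> U"
      using uv vv by auto
    have on: "orthonormal (insert v U)"
      using U(2) uv vv by (auto simp: orthonormal_def cinner_eq_0_commute[of v])
    have "cinner v x = cinner v y + cinner v (\<Sum>u\<in>U. cinner u x *\<^sub>C u)"
      by (simp add: y_def cinner_diff_right)
    also have "cinner v (\<Sum>u\<in>U. cinner u x *\<^sub>C u) = 0"
      by (auto simp: cinner_sum_right cinner_scaleC_right cinner_eq_0_commute[of v] uv intro!: sum.neutral)
    also have "cinner v y = complex_of_real (norm y)"
      using False by (simp add: v_def cinner_scaleC_left cinner_self power2_eq_square)
    finally have "cinner v x *\<^sub>C v = y"
      using False by (simp add: v_def scaleC_scaleC)
    then have x: "x = (\<Sum>u\<in>insert v U. cinner u x *\<^sub>C u)"
      using U vU by (simp add: y_def)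
    \<comment> \<open>The earlier vectors lie in the span of \<open>U\<close>, hence have no
      component along the new vector \<open>v\<close>.\<close>
    have "z = (\<Sum>u\<in>insert v U. cinner u z *\<^sub>C u)" if "z \<in> X" for z
    proof -
      have "cinner v z = (\<Sum>u\<in>U. cinner u z * cinner v u)"
        by (subst X[OF that]) (simp add: cinner_sum_right cinner_scaleC_right)
      then have "cinner v z = 0"
        by (auto simp: cinner_eq_0_commute[of v] uv intro!: sum.neutral)
      then show ?thesis
        using U vU X[OF that] by simp
    qed
    then show ?thesis
      using U(1) on x by (intro exI[of _ "insert v U"]) auto
  qed
qed

section \<open>Direct sums and tensor products\<close>

lemma has_sum_ell2_norm: "((\<lambda>i. (norm (ell2_nth x i))\<^sup>2) has_sum (norm x)\<^sup>2) UNIV"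
  using square_summable_ell2_nth[of x] unfolding norm_ell2_sq square_summable_def by simp

lemma has_sum_sum:
  assumes "\<And>u. u \<in> U \<Longrightarrow> (f u has_sum s u) A"
  shows "((\<lambda>i. \<Sum>u\<in>U. f u i) has_sum (\<Sum>u\<in>U. s u :: 'b::topological_comm_monoid_add)) A"
  using assms by (induction U rule: infinite_finite_induct) (auto intro: has_sum_add)

lemma bounded_clinear_ell2_nth: "bounded_clinear (\<lambda>x. ell2_nth x i)"
  by (rule bounded_clinearI[where C = 1])
    (auto simp: plus_ell2.rep_eq scaleC_ell2.rep_eq norm_ell2_nth_le)

lemma ell2_nth_sum: "ell2_nth (sum f A) i = (\<Sum>a\<in>A. ell2_nth (f a) i)"
  by (rule linear_sum[OF bounded_clinear_linear[OF bounded_clinear_ell2_nth]])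

lemma square_summable_subset_reindex:
  assumes "square_summable f" "inj h"
  shows "square_summable (\<lambda>i. f (h i))"
proof -
  have "(\<lambda>w. (norm (f w))\<^sup>2) summable_on range h"
    using assms(1) unfolding square_summable_def by (rule summable_on_subset) auto
  then show ?thesis
    using assms(2) by (subst (asm) summable_on_reindex) (auto simp: o_def square_summable_def)
qed

lemma square_summableI:
  assumes "\<And>F. finite F \<Longrightarrow> (\<Sum>i\<in>F. (norm (f i))\<^sup>2) \<le> C"
  shows "square_summable f"
  unfolding square_summable_def using assms
  by (intro nonneg_bdd_above_summable_on) (auto simp: bdd_above_def)

lemma square_summable_dominated:
  assumes "square_summable f" "\<And>i. norm (g i) \<le> C * norm (f i)"
  shows "square_summable g"
  unfolding square_summable_def
proof (rule summable_on_comparison_test)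
  show "(\<lambda>i. C\<^sup>2 * (norm (f i))\<^sup>2) summable_on UNIV"
    using assms(1) unfolding square_summable_def by (rule summable_on_cmult_right)
  show "(norm (g i))\<^sup>2 \<le> C\<^sup>2 * (norm (f i))\<^sup>2" for i
    using power_mono[OF assms(2)[of i], of 2] by (simp add: power_mult_distrib)
qed auto

lemma bounded_clinear_ell2I:
  fixes f :: "'x::chilbert_space \<Rightarrow> 'a \<Rightarrow> 'k::chilbert_space"
  assumes "\<And>i x y. f (x + y) i = f x i + f y i" and "\<And>c x i. f (c *\<^sub>C x) i = c *\<^sub>C f x i"
    and "\<And>F x. finite F \<Longrightarrow> (\<Sum>i\<in>F. (norm (f x i))\<^sup>2) \<le> (C * norm x)\<^sup>2" and "0 \<le> C"
  shows "\<exists>T. bounded_clinear T \<and> (\<forall>x i. ell2_nth (T x) i = f x i) \<and> (\<forall>x. norm (T x) \<le> C * norm x)"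
proof (intro exI conjI allI)
  define T where "T x = Abs_ell2 (f x)" for x
  have "square_summable (f x)" for x
    using assms(3) by (rule square_summableI)
  then show nth: "ell2_nth (T x) i = f x i" for x i
    by (simp add: T_def Abs_ell2_inverse)
  show le: "norm (T x) \<le> C * norm x" for x
    by (rule norm_ell2_leI) (use assms(3,4) in \<open>auto simp: nth\<close>)
  show "bounded_clinear T"
    by (rule bounded_clinearI[OF _ _ le])
      (auto intro!: ell2_eqI simp: nth plus_ell2.rep_eq scaleC_ell2.rep_eq assms(1,2))
qed

lift_definition ell2_single :: "'a \<Rightarrow> 'k \<Rightarrow> ('a, 'k::chilbert_space) ell2"
  is "\<lambda>i k j. if j = i then k else 0"
proof -
  fix i :: 'a and k :: 'k
  have "(\<lambda>j. (norm (if j = i then k else 0))\<^sup>2) summable_on {i}"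
    by (rule summable_on_finite) simp
  then show "square_summable (\<lambda>j. if j = i then k else 0)"
    unfolding square_summable_def by (rule summable_on_cong_neutral[THEN iffD1, rotated -1]) auto
qed

lemma infsum_single:
  fixes f :: "'a \<Rightarrow> 'b::{topological_comm_monoid_add, t2_space}"
  assumes "\<And>j. j \<noteq> i \<Longrightarrow> f j = 0"
  shows "(\<Sum>\<^sub>\<infinity>j. f j) = f i"
proof -
  have "(\<Sum>\<^sub>\<infinity>j. f j) = (\<Sum>\<^sub>\<infinity>j\<in>{i}. f j)"
    using assms by (intro infsum_cong_neutral) auto
  then show ?thesis
    by simp
qed

lemma cinner_ell2_single: "cinner (ell2_single i k) y = cinner k (ell2_nth y i)"
  unfolding cinner_ell2_def
  by (subst infsum_single[of i]) (auto simp: ell2_single.rep_eq)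

lemma ell2_single_dense:
  assumes H: "closed_csubspace H" and single: "\<And>i k. ell2_single i k \<in> H"
  shows "x \<in> H"
proof (rule closed_csubspace_eq_UNIV[OF H])
  fix y assume "y \<in> orth_compl H"
  then have "cinner k (ell2_nth y i) = 0" for i k
    using single by (auto simp: orth_compl_def cinner_ell2_single[symmetric])
  then have "ell2_nth y i = 0" for i
    by (metis cinner_self_eq_0)
  then show "y = 0"
    by (intro ell2_eqI) (simp add: zero_ell2.rep_eq)
qed

lemma bounded_clinear_eqI_single:
  assumes "bounded_clinear S" "bounded_clinear T"
    and "\<And>i k. S (ell2_single i k) = T (ell2_single i k)"
  shows "S x = T x"
  using ell2_single_dense[OF closed_csubspace_eq[OF assms(1,2)], of x] assms(3) by auto

text \<open>The vectors \<open>y\<close> for which the pairing converges form a subspace, closed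
  thanks to the uniform norm bound. Convergence of coordinates puts all one-coordinate vectors into
  it, and these are dense.\<close>

lemma bounded_coordinatewise_imp_weak_tendsto:
  assumes bound: "\<And>m. norm (z m) \<le> C" and coord: "\<And>i. (\<lambda>m. ell2_nth (z m) i) \<longlonglongrightarrow> ell2_nth l i"
  shows "(\<lambda>m. cinner y (z m)) \<longlonglongrightarrow> cinner y l"
proof -
  define D where "D = {y. (\<lambda>m. cinner y (z m - l)) \<longlonglongrightarrow> 0}"
  define B where "B = C + norm l"
  have B: "norm (z m - l) \<le> B" for m
    using norm_triangle_ineq4[of "z m" l] bound[of m] by (simp add: B_def)
  then have B0: "0 \<le> B"
    using norm_ge_zero order_trans by blast
  have "closed D"
    unfolding closed_sequential_limits
  proof safe
    fix x y assume x: "\<forall>n. x n \<in> D" "x \<longlonglongrightarrow> y"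
    show "y \<in> D"
      unfolding D_def mem_Collect_eq
    proof (rule LIMSEQ_I)
      fix e :: real assume "e > 0"
      \<comment> \<open>The bound \<open>B\<close> may be zero, hence the denominator
        \<open>B + 1\<close>.\<close>
      then have "e / (2 * (B + 1)) > 0"
        using B0 by simp
      then obtain n where n: "norm (x n - y) < e / (2 * (B + 1))"
        using x(2) LIMSEQ_D by blast
      have "(\<lambda>m. cinner (x n) (z m - l)) \<longlonglongrightarrow> 0"
        using x(1) by (simp add: D_def)
      then obtain N where N: "\<And>m. m \<ge> N \<Longrightarrow> cmod (cinner (x n) (z m - l)) < e / 2"
        using LIMSEQ_D[of "\<lambda>m. cinner (x n) (z m - l)" 0 "e / 2"] \<open>e > 0\<close> by auto
      have "cmod (cinner y (z m - l)) < e" if "m \<ge> N" for m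
      proof -
        have "cmod (cinner (y - x n) (z m - l)) \<le> norm (x n - y) * norm (z m - l)"
          using norm_cinner_le[of "y - x n" "z m - l"] by (simp add: norm_minus_commute)
        also have "\<dots> \<le> e / (2 * (B + 1)) * (B + 1)"
          using n B[of m] B0 \<open>e > 0\<close> by (intro mult_mono) auto
        also have "\<dots> = e / 2"
          using B0 by (simp add: field_simps)
        finally have 1: "cmod (cinner (y - x n) (z m - l)) \<le> e / 2" .
        have "cinner y (z m - l) = cinner (y - x n) (z m - l) + cinner (x n) (z m - l)"
          by (simp add: cinner_diff_left)
        then have "cmod (cinner y (z m - l)) \<le> cmod (cinner (y - x n) (z m - l)) + cmod (cinner (x n) (z m - l))"
          by (metis norm_triangle_ineq)
        then show ?thesis
          using 1 N[OF that] by simp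
      qed
      then show "\<exists>N. \<forall>m\<ge>N. norm (cinner y (z m - l) - 0) < e"
        by auto
    qed
  qed
  then have D: "closed_csubspace D"
    by (auto simp: closed_csubspace_def D_def cinner_add_left cinner_scaleC_left
        intro: tendsto_add_zero tendsto_mult_right_zero)
  have "y \<in> D"
  proof (rule ell2_single_dense[OF D])
    fix i k
    have "(\<lambda>m. cinner k (ell2_nth (z m) i - ell2_nth l i)) \<longlonglongrightarrow> cinner k 0"
      using coord[of i] by (intro bounded_linear.tendsto[OF bounded_linear_cinner_right])
        (simp add: LIM_zero)
    then show "ell2_single i k \<in> D"
      by (simp add: D_def cinner_ell2_single minus_ell2.rep_eq)
  qed
  then have "(\<lambda>m. cinner y (z m) - cinner y l) \<longlonglongrightarrow> 0"
    by (simp add: D_def cinner_diff_right)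
  then show ?thesis
    by (rule LIM_zero_cancel)
qed


subsection \<open>Tensor products of operators\<close>

lift_definition slice :: "'k \<Rightarrow> ('a, 'k::chilbert_space) ell2 \<Rightarrow> ('a, complex) ell2"
  is "\<lambda>k x j. cinner k (x j)"
  by (erule square_summable_dominated) (rule norm_cinner_le)

lemma slice_add: "slice k (x + y) = slice k x + slice k y"
  and slice_scaleC: "slice k (c *\<^sub>C x) = c *\<^sub>C slice k x"
  and slice_add_left: "slice (k + l) x = slice k x + slice l x"
  and slice_scaleC_left: "slice (c *\<^sub>C k) x = cnj c *\<^sub>C slice k x"
  and slice_elementary: "slice k (elementary_tensor \<phi> g) = cinner k g *\<^sub>C \<phi>"
  by (auto intro!: ell2_eqI simp: slice.rep_eq plus_ell2.rep_eq scaleC_ell2.rep_eq scaleC_complex_def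
      cinner_add_right cinner_add_left cinner_scaleC_right cinner_scaleC_left elementary_tensor.rep_eq)

lemma norm_slice_le: "norm (slice k (x :: ('a, 'k::chilbert_space) ell2)) \<le> norm k * norm x"
proof (rule norm_ell2_leI)
  fix F :: "'a set" assume "finite F"
  have "(\<Sum>i\<in>F. (norm (ell2_nth (slice k x) i))\<^sup>2) \<le> (\<Sum>i\<in>F. (norm k)\<^sup>2 * (norm (ell2_nth x i))\<^sup>2)"
    by (intro sum_mono) (auto simp: slice.rep_eq power_mult_distrib[symmetric] norm_cinner_le intro!: power_mono)
  also have "\<dots> \<le> (norm k)\<^sup>2 * (norm x)\<^sup>2"
    unfolding sum_distrib_left[symmetric]
    using sum_norm_ell2_nth_le[OF \<open>finite F\<close>] by (intro mult_left_mono) auto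
  finally show "(\<Sum>i\<in>F. (norm (ell2_nth (slice k x) i))\<^sup>2) \<le> (norm k * norm x)\<^sup>2"
    by (simp add: power_mult_distrib)
qed auto

text \<open>Bessel's inequality in each coordinate, summed over the coordinates.\<close>

lemma sum_norm_slice_le:
  assumes "finite U" "orthonormal U"
  shows "(\<Sum>u\<in>U. (norm (slice u x))\<^sup>2) \<le> (norm x)\<^sup>2"
proof (rule has_sum_mono)
  show "((\<lambda>i. \<Sum>u\<in>U. (norm (ell2_nth (slice u x) i))\<^sup>2) has_sum (\<Sum>u\<in>U. (norm (slice u x))\<^sup>2)) UNIV"
    by (intro has_sum_sum has_sum_ell2_norm)
  show "((\<lambda>i. (norm (ell2_nth x i))\<^sup>2) has_sum (norm x)\<^sup>2) UNIV"
    by (rule has_sum_ell2_norm)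
qed (use bessel_inequality[OF assms] in \<open>simp add: slice.rep_eq\<close>)

text \<open>The operator \<open>X\<close> is $A\otimes I$. Its norm is estimated through the slices along an
  orthonormal basis of the span of finitely many coordinates of \<open>X x\<close>.\<close>

lemma ex_ampliation:
  fixes A :: "('a, complex) ell2 \<Rightarrow> ('b, complex) ell2"
  assumes A: "bounded_clinear A"
  shows "\<exists>X :: ('a, 'k::chilbert_space) ell2 \<Rightarrow> ('b, 'k) ell2.
    bounded_clinear X \<and> (\<forall>k x. slice k (X x) = A (slice k x))"
proof -
  obtain C where C: "0 \<le> C" "\<And>x. norm (A x) \<le> norm x * C"
    using bounded_linear.nonneg_bounded[OF bounded_clinear_imp_bounded_linear[OF A]] by blast
  have linA: "linear A"
    by (rule bounded_clinear_linear[OF A])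
  \<comment> \<open>A coordinate of \<open>X x\<close> is prescribed by its pairings with all
    \<open>k\<close>. The slice is conjugate linear in \<open>k\<close>, so the conjugate of the
    prescribed value is a bounded functional and Riesz supplies the vector.\<close>
  have "\<exists>z. \<forall>k. cinner k z = ell2_nth (A (slice k x)) i" for x :: "('a, 'k) ell2" and i
  proof -
    have "bounded_clinear (\<lambda>k. cnj (ell2_nth (A (slice k x)) i))"
    proof (rule bounded_clinearI)
      fix k
      have "norm (ell2_nth (A (slice k x)) i) \<le> norm (A (slice k x))"
        by (rule norm_ell2_nth_le)
      also have "\<dots> \<le> norm (slice k x) * C"
        by (rule C)
      also have "\<dots> \<le> (norm k * norm x) * C"
        by (intro mult_right_mono norm_slice_le C)
      finally show "norm (cnj (ell2_nth (A (slice k x)) i)) \<le> (norm x * C) * norm k"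
        by (simp add: algebra_simps)
    qed (auto simp: slice_add_left slice_scaleC_left linear_add[OF linA] bounded_clinear_scaleC[OF A]
        plus_ell2.rep_eq scaleC_ell2.rep_eq scaleC_complex_def)
    from riesz_representation[OF this] obtain z where
      "\<And>k. cnj (ell2_nth (A (slice k x)) i) = cinner z k"
      by blast
    then have "cinner k z = ell2_nth (A (slice k x)) i" for k
      by (metis cinner_commute complex_cnj_cnj)
    then show ?thesis
      by blast
  qed
  then obtain f where f: "\<And>x i k. cinner k (f x i) = ell2_nth (A (slice k (x :: ('a, 'k) ell2))) i"
    by metis
  have bound: "(\<Sum>i\<in>F. (norm (f x i))\<^sup>2) \<le> (C * norm x)\<^sup>2" if F: "finite F" for F x
  proof -
    obtain U where U: "finite U" "orthonormal U"
      and fU: "\<And>i. i \<in> F \<Longrightarrow> f x i = (\<Sum>u\<in>U. cinner u (f x i) *\<^sub>C u)"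
      using ex_finite_orthonormal_basis[of "f x ` F"] F by blast
    have "(\<Sum>i\<in>F. (norm (f x i))\<^sup>2) = (\<Sum>i\<in>F. \<Sum>u\<in>U. (cmod (cinner u (f x i)))\<^sup>2)"
      by (intro sum.cong refl, subst fU) (simp_all only: norm_orthonormal_sum[OF U])
    also have "\<dots> = (\<Sum>u\<in>U. \<Sum>i\<in>F. (cmod (ell2_nth (A (slice u x)) i))\<^sup>2)"
      unfolding f by (rule sum.swap)
    also have "\<dots> \<le> (\<Sum>u\<in>U. (norm (A (slice u x)))\<^sup>2)"
      by (intro sum_mono sum_norm_ell2_nth_le F)
    also have "\<dots> \<le> (\<Sum>u\<in>U. (norm (slice u x) * C)\<^sup>2)"
      by (intro sum_mono power_mono C) auto
    also have "\<dots> \<le> (norm x)\<^sup>2 * C\<^sup>2"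
      unfolding power_mult_distrib sum_distrib_right[symmetric]
      by (intro mult_right_mono sum_norm_slice_le U) auto
    finally show ?thesis
      by (simp add: power_mult_distrib mult.commute)
  qed
  have "f (x + y) i = f x i + f y i" "f (c *\<^sub>C x) i = c *\<^sub>C f x i" for x y c i
    by (rule cinner_ext, simp add: f cinner_add_right cinner_scaleC_right slice_add slice_scaleC
        linear_add[OF linA] bounded_clinear_scaleC[OF A] plus_ell2.rep_eq scaleC_ell2.rep_eq
        scaleC_complex_def)+
  from bounded_clinear_ell2I[OF this bound C(1)]
  obtain X where X: "bounded_clinear X" "\<And>x i. ell2_nth (X x) i = f x i"
    by blast
  have "slice k (X x) = A (slice k x)" for k x
    by (rule ell2_eqI) (simp add: slice.rep_eq X f)
  then show ?thesis
    using X by blast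
qed

lemma ex_right_ampliation:
  assumes T: "bounded_clinear T"
  shows "\<exists>X. bounded_clinear X \<and>
    (\<forall>(x :: ('a, 'b::chilbert_space) ell2) i. ell2_nth (X x :: ('a, 'k::chilbert_space) ell2) i = T (ell2_nth x i))"
proof -
  obtain C where C: "0 \<le> C" "\<And>x. norm (T x) \<le> norm x * C"
    using bounded_linear.nonneg_bounded[OF bounded_clinear_imp_bounded_linear[OF T]] by blast
  have bound: "(\<Sum>i\<in>F. (norm (T (ell2_nth x i)))\<^sup>2) \<le> (C * norm x)\<^sup>2" if F: "finite F" for F and x :: "('a, 'b) ell2"
  proof -
    have "(\<Sum>i\<in>F. (norm (T (ell2_nth x i)))\<^sup>2) \<le> (\<Sum>i\<in>F. (norm (ell2_nth x i) * C)\<^sup>2)"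
      by (intro sum_mono power_mono C) auto
    also have "\<dots> \<le> (norm x)\<^sup>2 * C\<^sup>2"
      unfolding power_mult_distrib sum_distrib_right[symmetric]
      by (intro mult_right_mono sum_norm_ell2_nth_le F) auto
    finally show ?thesis
      by (simp add: power_mult_distrib mult.commute)
  qed
  have "T (ell2_nth (x + y) i) = T (ell2_nth x i) + T (ell2_nth y i)"
    "T (ell2_nth (c *\<^sub>C x) i) = c *\<^sub>C T (ell2_nth x i)" for c i and x y :: "('a, 'b) ell2"
    by (simp_all add: plus_ell2.rep_eq scaleC_ell2.rep_eq bounded_clinear_scaleC[OF T]
        linear_add[OF bounded_clinear_linear[OF T]])
  from bounded_clinear_ell2I[OF this bound C(1)] show ?thesis
    by blast
qed

lemma elementary_tensor_single: "elementary_tensor (ell2_single i 1) k = ell2_single i k"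
  by (rule ell2_eqI) (simp add: elementary_tensor.rep_eq ell2_single.rep_eq)

lemma elementary_tensor_dense:
  assumes "closed_csubspace H" and "\<And>\<phi> k. elementary_tensor \<phi> k \<in> H"
  shows "x \<in> H"
  using assms ell2_single_dense by (metis elementary_tensor_single)

lemma bounded_clinear_eqI_tensor:
  assumes "bounded_clinear S" "bounded_clinear T"
    and "\<And>\<phi> k. S (elementary_tensor \<phi> k) = T (elementary_tensor \<phi> k)"
  shows "S x = T x"
  using elementary_tensor_dense[OF closed_csubspace_eq[OF assms(1,2)], of x] assms(3) by auto

lemma
  fixes A :: "('a, complex) ell2 \<Rightarrow> ('b, complex) ell2" and T :: "'g::chilbert_space \<Rightarrow> 'k::chilbert_space"
  assumes A: "bounded_clinear A" and T: "bounded_clinear T"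
  shows bounded_clinear_tensor_op: "bounded_clinear (tensor_op A T)"
    and tensor_op_elementary: "tensor_op A T (elementary_tensor \<phi> g) = elementary_tensor (A \<phi>) (T g)"
proof -
  obtain X :: "('a, 'k) ell2 \<Rightarrow> ('b, 'k) ell2"
    where X: "bounded_clinear X" "\<And>k x. slice k (X x) = A (slice k x)"
    using ex_ampliation[OF A] by blast
  obtain Y :: "('a, 'g) ell2 \<Rightarrow> ('a, 'k) ell2"
    where Y: "bounded_clinear Y" "\<And>x i. ell2_nth (Y x) i = T (ell2_nth x i)"
    using ex_right_ampliation[OF T] by blast
  have Yt: "Y (elementary_tensor \<phi> g) = elementary_tensor \<phi> (T g)" for \<phi> g
    by (rule ell2_eqI) (simp add: Y elementary_tensor.rep_eq bounded_clinear_scaleC[OF T])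
  have Xt: "X (elementary_tensor \<phi> g) = elementary_tensor (A \<phi>) g" for \<phi> g
  proof (rule ell2_eqI, rule cinner_ext)
    fix i k
    have "cinner k (ell2_nth (X (elementary_tensor \<phi> g)) i) = ell2_nth (slice k (X (elementary_tensor \<phi> g))) i"
      by (simp add: slice.rep_eq)
    then show "cinner k (ell2_nth (X (elementary_tensor \<phi> g)) i) = cinner k (ell2_nth (elementary_tensor (A \<phi>) g) i)"
      by (simp add: X slice_elementary bounded_clinear_scaleC[OF A] scaleC_ell2.rep_eq
          elementary_tensor.rep_eq cinner_scaleC_right scaleC_complex_def mult.commute)
  qed
  let ?P = "\<lambda>Z. bounded_clinear Z \<and> (\<forall>\<phi> g. Z (elementary_tensor \<phi> g) = elementary_tensor (A \<phi>) (T g))"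
  have "\<exists>!Z. ?P Z"
  proof (rule ex1I)
    show XY: "?P (X \<circ> Y)"
      by (simp add: bounded_clinear_compose X Y Xt Yt)
    show "Z = X \<circ> Y" if "?P Z" for Z
      using XY that bounded_clinear_eqI_tensor[of Z "X \<circ> Y"] by auto
  qed
  from theI'[OF this] show "bounded_clinear (tensor_op A T)"
    "tensor_op A T (elementary_tensor \<phi> g) = elementary_tensor (A \<phi>) (T g)"
    unfolding tensor_op_def by auto
qed

lemma tensor_op_eqI:
  assumes "bounded_clinear A" "bounded_clinear T" "bounded_clinear X"
    and "\<And>\<phi> g. X (elementary_tensor \<phi> g) = elementary_tensor (A \<phi>) (T g)"
  shows "tensor_op A T = X"
proof
  show "tensor_op A T x = X x" for x
    by (rule bounded_clinear_eqI_tensor[OF bounded_clinear_tensor_op[OF assms(1,2)] assms(3)])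
      (simp add: tensor_op_elementary assms)
qed

lemma tensor_op_compose:
  assumes "bounded_clinear A" "bounded_clinear T" "bounded_clinear B" "bounded_clinear S"
  shows "tensor_op A T (tensor_op B S x) = tensor_op (A \<circ> B) (T \<circ> S) x"
proof -
  have "tensor_op (A \<circ> B) (T \<circ> S) = tensor_op A T \<circ> tensor_op B S"
    using assms by (intro tensor_op_eqI)
      (simp_all add: tensor_op_elementary bounded_clinear_compose bounded_clinear_tensor_op)
  then show ?thesis
    by simp
qed

lemma tensor_op_id_left:
  assumes "bounded_clinear T"
  shows "ell2_nth (tensor_op id T x) i = T (ell2_nth x i)"
proof -
  obtain Y where Y: "bounded_clinear Y" "\<And>x i. ell2_nth (Y x :: ('c, 'b) ell2) i = T (ell2_nth x i)"
    using ex_right_ampliation[OF assms] by blast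
  have "tensor_op id T = Y"
    by (intro tensor_op_eqI Y assms bounded_clinear_id ell2_eqI)
      (simp add: Y elementary_tensor.rep_eq bounded_clinear_scaleC[OF assms])
  then show ?thesis
    by (simp add: Y)
qed

lemma cinner_elementary_tensor:
  "cinner (elementary_tensor \<phi> g) (elementary_tensor \<psi> h) = cinner \<phi> \<psi> * cinner g h"
proof -
  have "cinner (elementary_tensor \<phi> g) (elementary_tensor \<psi> h)
      = (\<Sum>\<^sub>\<infinity>i. cinner (ell2_nth \<phi> i) (ell2_nth \<psi> i) * cinner g h)"
    by (simp add: cinner_ell2_def elementary_tensor.rep_eq cinner_scaleC_left cinner_scaleC_right
        cinner_complex_def mult_ac)
  also have "\<dots> = cinner \<phi> \<psi> * cinner g h"
    unfolding cinner_ell2_def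
    by (intro infsum_cmult_left cinner_summable square_summable_ell2_nth)
  finally show ?thesis .
qed

text \<open>The inner product is linear only in its second argument, so the density argument runs
  once per variable, with a conjugation in between.\<close>

lemma cinner_adjointI_tensor:
  assumes X: "bounded_clinear X" and Y: "bounded_clinear Y"
    and eq: "\<And>\<phi> g \<psi> h. cinner (elementary_tensor \<phi> g) (X (elementary_tensor \<psi> h))
      = cinner (Y (elementary_tensor \<phi> g)) (elementary_tensor \<psi> h)"
  shows "cinner x (X y) = cinner (Y x) y"
proof -
  have 1: "cinner (elementary_tensor \<phi> g) (X y) = cinner (Y (elementary_tensor \<phi> g)) y" for \<phi> g y
    by (rule bounded_clinear_eqI_tensor[where x = y])
      (use bounded_clinear_compose[OF bounded_clinear_cinner_right X] in
        \<open>auto simp: eq o_def bounded_clinear_cinner_right\<close>)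
  have "cinner (X y) x = cinner y (Y x)" for y x
  proof (rule bounded_clinear_eqI_tensor[where x = x])
    show "cinner (X y) (elementary_tensor \<phi> g) = cinner y (Y (elementary_tensor \<phi> g))" for \<phi> g
      using 1[of \<phi> g y] by (metis cinner_commute)
  qed (use bounded_clinear_compose[OF bounded_clinear_cinner_right Y] in
      \<open>auto simp: o_def bounded_clinear_cinner_right\<close>)
  then show ?thesis
    by (metis cinner_commute)
qed


subsection \<open>Tensor products of subspaces\<close>

context
  fixes N :: "('a, complex) ell2 set" and G :: "'g::chilbert_space set"
  assumes N: "closed_csubspace N" and G: "closed_csubspace G"
begin

lemma closed_csubspace_tensor_space: "closed_csubspace (tensor_space N G)"
  unfolding tensor_space_def by (rule closed_csubspace_closed_cspan)

lemma elementary_in_tensor_space: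
  "\<phi> \<in> N \<Longrightarrow> g \<in> G \<Longrightarrow> elementary_tensor \<phi> g \<in> tensor_space N G"
  unfolding tensor_space_def by (rule subsetD[OF closed_cspan_superset]) auto

text \<open>The tensor product of the projections maps into the tensor space, fixes it pointwise and
  is self-adjoint; this characterises the orthogonal projection.\<close>

lemma proj_tensor_space: "proj (tensor_space N G) = tensor_op (proj N) (proj G)"
proof
  fix x
  let ?P = "tensor_op (proj N) (proj G)"
  note bp = bounded_clinear_proj[OF N] bounded_clinear_proj[OF G]
  note bP = bounded_clinear_tensor_op[OF bp]
  have in_space: "?P y \<in> tensor_space N G" for y
    using elementary_tensor_dense[OF closed_csubspace_vimage[OF bP closed_csubspace_tensor_space], of y]
    by (simp add: tensor_op_elementary bp elementary_in_tensor_space proj_in N G)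
  have "tensor_space N G \<subseteq> {y. ?P y = id y}"
    unfolding tensor_space_def
    by (rule closed_cspan_minimal[OF _ closed_csubspace_eq[OF bP bounded_clinear_id(1)]])
      (auto simp: tensor_op_elementary bp proj_ident N G)
  then have fix_space: "y \<in> tensor_space N G \<Longrightarrow> ?P y = y" for y
    by auto
  have adj: "cinner y (?P z) = cinner (?P y) z" for y z
    by (rule cinner_adjointI_tensor[OF bP bP])
      (simp add: tensor_op_elementary bp cinner_elementary_tensor proj_self_adjoint N G)
  show "proj (tensor_space N G) x = ?P x"
  proof (rule proj_eqI[OF closed_csubspace_tensor_space in_space])
    show "x - ?P x \<in> orth_compl (tensor_space N G)"
      by (auto simp: orth_compl_def cinner_diff_right adj fix_space)
  qed
qed

end

section \<open>Creation operators on the Fock space\<close>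

text \<open>Only \<open>x'\<close> has to vanish off the range of \<open>h\<close>;
  \<open>y'\<close> may be arbitrary there. This asymmetry lets one lemma yield both an adjoint
  relation and the isometry of a shift.\<close>

lemma cinner_ell2_reindex:
  assumes "inj h"
    and "\<And>v. ell2_nth x' (h v) = ell2_nth x v" "\<And>w. w \<notin> range h \<Longrightarrow> ell2_nth x' w = 0"
    and "\<And>v. ell2_nth y' (h v) = ell2_nth y v"
  shows "cinner x' y' = cinner x y"
proof -
  have "cinner x' y' = (\<Sum>\<^sub>\<infinity>w\<in>range h. cinner (ell2_nth x' w) (ell2_nth y' w))"
    unfolding cinner_ell2_def using assms(3) by (intro infsum_cong_neutral) auto
  also have "\<dots> = cinner x y"
    unfolding cinner_ell2_def using assms by (subst infsum_reindex) (auto simp: o_def)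
  finally show ?thesis .
qed

lemma norm_eq_if_cinner_eq: "cinner x x = cinner y y \<Longrightarrow> norm x = norm y"
  unfolding cinner_self of_real_eq_iff by (simp add: power2_eq_iff_nonneg)

lift_definition lcreate :: "'n \<Rightarrow> ('n list, 'k::chilbert_space) ell2 \<Rightarrow> ('n list, 'k) ell2"
  is "\<lambda>i x w. if w \<noteq> [] \<and> hd w = i then x (tl w) else 0"
  subgoal for i x
    by (rule square_summable_extend[of x "\<lambda>v. i # v"])
       (auto simp: inj_on_def image_def neq_Nil_conv)
  done

text \<open>The adjoint of \<open>lcreate i\<close>, by \<open>cinner_lcreate_left\<close>.\<close>

lift_definition lannih :: "'n \<Rightarrow> ('n list, 'k::chilbert_space) ell2 \<Rightarrow> ('n list, 'k) ell2"
  is "\<lambda>i x w. x (i # w)"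
  by (rule square_summable_subset_reindex) (auto simp: inj_on_def)

lemma lcreate_nth [simp]:
  "ell2_nth (lcreate i x) [] = 0"
  "ell2_nth (lcreate i x) (j # w) = (if j = i then ell2_nth x w else 0)"
  by (auto simp: lcreate.rep_eq)

lemma cinner_lcreate_left: "cinner (lcreate i x) y = cinner x (lannih i y)"
  by (rule cinner_ell2_reindex[of "\<lambda>v. i # v"])
    (auto simp: inj_on_def image_def neq_Nil_conv lcreate.rep_eq lannih.rep_eq)

lemma lannih_lcreate: "lannih j (lcreate i x) = (if i = j then x else 0)"
  by (auto intro!: ell2_eqI simp: lannih.rep_eq zero_ell2.rep_eq)

lemma norm_lcreate: "norm (lcreate i x) = norm x"
  by (rule norm_eq_if_cinner_eq) (simp add: cinner_lcreate_left lannih_lcreate)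

lemma bounded_clinear_lcreate: "bounded_clinear (lcreate i)"
  by (rule bounded_clinearI[where C = 1])
    (auto intro!: ell2_eqI simp: norm_lcreate lcreate.rep_eq plus_ell2.rep_eq scaleC_ell2.rep_eq)

lemma norm_lannih_le: "norm (lannih i x) \<le> norm x"
proof -
  have "(norm (lannih i x))\<^sup>2 = Re (cinner (lcreate i (lannih i x)) x)"
    by (metis Re_complex_of_real cinner_lcreate_left cinner_self)
  also have "\<dots> \<le> norm (lannih i x) * norm x"
    using norm_cinner_le[of "lcreate i (lannih i x)" x] complex_Re_le_cmod order_trans
    by (metis norm_lcreate)
  finally show ?thesis
    by (cases "lannih i x = 0") (auto simp: power2_eq_square)
qed

lemma bounded_clinear_lannih: "bounded_clinear (lannih i)"
  by (rule bounded_clinearI[where C = 1])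
    (auto intro!: ell2_eqI simp: norm_lannih_le lannih.rep_eq plus_ell2.rep_eq scaleC_ell2.rep_eq)

lemma left_creation_eq: "left_creation = lcreate"
  by (intro ext ell2_eqI) (simp add: left_creation.rep_eq lcreate.rep_eq)

lemma bounded_clinear_left_creation: "bounded_clinear (left_creation i)"
  by (simp add: left_creation_eq bounded_clinear_lcreate)

lemma norm_right_creation: "norm (right_creation i x) = norm x"
proof (rule norm_eq_if_cinner_eq, rule cinner_ell2_reindex[of "\<lambda>v. v @ [i]"])
  show "ell2_nth (right_creation i x) w = 0" if "w \<notin> range (\<lambda>v. v @ [i])" for w
  proof -
    have "w = [] \<or> last w \<noteq> i"
      using that append_butlast_last_id[of w] by (metis rangeI)
    then show ?thesis
      by (auto simp: right_creation.rep_eq)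
  qed
qed (auto simp: inj_on_def right_creation.rep_eq)

lemma bounded_clinear_right_creation: "bounded_clinear (right_creation i)"
  by (rule bounded_clinearI[where C = 1])
    (auto intro!: ell2_eqI simp: norm_right_creation right_creation.rep_eq plus_ell2.rep_eq scaleC_ell2.rep_eq)

lemma left_right_creation_commute:
  "left_creation i (right_creation j x) = right_creation j (left_creation i x)"
proof (rule ell2_eqI)
  fix w
  show "ell2_nth (left_creation i (right_creation j x)) w = ell2_nth (right_creation j (left_creation i x)) w"
    by (cases w; cases "tl w" rule: rev_cases)
      (auto simp: left_creation.rep_eq right_creation.rep_eq)
qed

lemma tensor_op_left_creation: "tensor_op (left_creation i) id = lcreate i"
  by (rule tensor_op_eqI)
    (auto intro!: ell2_eqI simp: bounded_clinear_left_creation bounded_clinear_id bounded_clinear_lcreate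
      elementary_tensor.rep_eq lcreate.rep_eq left_creation.rep_eq)

primrec rcreate_word :: "'n list \<Rightarrow> 'n fock \<Rightarrow> 'n fock" where
  "rcreate_word [] \<phi> = \<phi>"
| "rcreate_word (i # u) \<phi> = rcreate_word u (right_creation i \<phi>)"

lemma bounded_clinear_rcreate_word: "bounded_clinear (rcreate_word u)"
proof (induction u)
  case Nil
  show ?case
    by (simp add: bounded_clinear_id(2))
next
  case (Cons i u)
  then show ?case
    using bounded_clinear_compose[OF Cons bounded_clinear_right_creation[of i]] by (simp add: o_def)
qed

lemma rcreate_word_nth_append: "ell2_nth (rcreate_word u \<phi>) (w @ u) = ell2_nth \<phi> w"
proof (induction u arbitrary: \<phi> w)
  case (Cons i u)
  then show ?case
    using Cons[of "right_creation i \<phi>" "w @ [i]"] by (simp add: right_creation.rep_eq)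
qed simp

lemma rcreate_word_nth_eq_0:
  "(\<And>w. v \<noteq> w @ u) \<Longrightarrow> ell2_nth (rcreate_word u \<phi>) v = 0"
proof (induction u arbitrary: \<phi> v)
  case (Cons i u)
  show ?case
  proof (cases "\<exists>w. v = w @ u")
    case True
    then obtain w where w: "v = w @ u"
      by blast
    have "w = [] \<or> last w \<noteq> i"
      using Cons.prems w by (metis append_Cons append_Nil append_assoc append_butlast_last_id)
    then show ?thesis
      by (auto simp: w rcreate_word_nth_append right_creation.rep_eq)
  next
    case False
    then show ?thesis
      by (simp add: Cons.IH)
  qed
next
  case Nil
  from Nil[of v] show ?case
    by simp
qed

text \<open>Appending \<open>u\<close> moves the coordinate at \<open>w\<close> to
  \<open>w @ u\<close>; the \<open>take\<close> recovers \<open>w\<close> from \<open>v\<close>.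
  Both sides are bounded and linear in \<open>x\<close>, so elementary tensors decide.\<close>

lemma tensor_op_rcreate_word_nth:
  assumes T: "bounded_clinear T"
  shows "ell2_nth (tensor_op (rcreate_word u) T x) v
    = (if \<exists>w. v = w @ u then T (ell2_nth x (take (length v - length u) v)) else 0)"
proof -
  have 1: "bounded_clinear (\<lambda>x. ell2_nth (tensor_op (rcreate_word u) T x) v)"
    using bounded_clinear_compose[OF bounded_clinear_ell2_nth
        bounded_clinear_tensor_op[OF bounded_clinear_rcreate_word T]]
    by (simp add: o_def)
  have 2: "bounded_clinear (\<lambda>x. if \<exists>w. v = w @ u then T (ell2_nth x (take (length v - length u) v)) else 0)"
    using bounded_clinear_compose[OF T bounded_clinear_ell2_nth]
    by (intro bounded_clinear_if) (simp add: o_def)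
  show ?thesis
  proof (rule bounded_clinear_eqI_tensor[OF 1 2])
    fix \<phi> g
    show "ell2_nth (tensor_op (rcreate_word u) T (elementary_tensor \<phi> g)) v
      = (if \<exists>w. v = w @ u then T (ell2_nth (elementary_tensor \<phi> g) (take (length v - length u) v)) else 0)"
      by (auto simp: tensor_op_elementary bounded_clinear_rcreate_word T elementary_tensor.rep_eq
          rcreate_word_nth_append rcreate_word_nth_eq_0 bounded_clinear_scaleC)
  qed
qed


section \<open>Operator algebras\<close>

lemma closedin_pullback_topology_iff:
  "closedin (pullback_topology A f euclidean) S \<longleftrightarrow> (\<exists>C. closed C \<and> S = f -` C \<inter> A)"
proof
  assume "closedin (pullback_topology A f euclidean) S"
  then obtain U where U: "open U" "A - S = f -` U \<inter> A" and S: "S \<subseteq> A"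
    by (auto simp: closedin_def topspace_pullback_topology openin_pullback_topology)
  then have "S = f -` (- U) \<inter> A"
    by blast
  then show "\<exists>C. closed C \<and> S = f -` C \<inter> A"
    using U(1) by blast
next
  assume "\<exists>C. closed C \<and> S = f -` C \<inter> A"
  then obtain C where C: "closed C" "S = f -` C \<inter> A"
    by blast
  then have "A - S = f -` (- C) \<inter> A"
    by blast
  then show "closedin (pullback_topology A f euclidean) S"
    using C by (auto simp: closedin_def topspace_pullback_topology openin_pullback_topology
        intro!: exI[of _ "- C"])
qed

text \<open>Convergence of all matrix coefficients is convergence in the product topology that is
  pulled back, and closed sets there are sequentially closed.\<close>

lemma closedin_wot_sequentially:
  assumes "closedin (wot H K) \<X>" and "\<And>m. X m \<in> \<X>" and "L \<in> bops H K"
    and lim: "\<And>x y. (\<lambda>m. cinner y (X m x)) \<longlonglongrightarrow> cinner y (L x)"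
  shows "L \<in> \<X>"
proof -
  let ?f = "\<lambda>T (x, y). cinner y (T x)"
  obtain C where C: "closed C" "\<X> = ?f -` C \<inter> bops H K"
    using assms(1) unfolding wot_def closedin_pullback_topology_iff by blast
  have "(\<lambda>m. ?f (X m)) \<longlonglongrightarrow> ?f L"
  proof -
    have "limitin (product_topology (\<lambda>_. euclidean) UNIV) (\<lambda>m. ?f (X m)) (?f L) sequentially"
      unfolding limitin_componentwise using lim by (simp add: split_beta)
    then show ?thesis
      by (simp add: euclidean_product_topology)
  qed
  moreover have "?f (X m) \<in> C" for m
    using assms(2)[of m] C by blast
  ultimately have "?f L \<in> C"
    by (rule closed_sequentially[OF C(1), rotated])
  then show ?thesis
    using assms(3) C(2) by blast
qed

lemma bops_bounded_clinear: "X \<in> bops H K \<Longrightarrow> bounded_clinear X"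
  and bops_range: "X \<in> bops H K \<Longrightarrow> X x \<in> K"
  and bops_orth: "X \<in> bops H K \<Longrightarrow> x \<in> orth_compl H \<Longrightarrow> X x = 0"
  by (auto simp: bops_def)

lemma op_subspace_bops: "closed_csubspace K \<Longrightarrow> op_subspace (bops H K)"
  by (auto simp: op_subspace_def bops_def image_subset_iff bounded_clinear_0
      intro: bounded_clinear_add bounded_clinear_const_scaleC closed_csubspace_0
        closed_csubspace_add closed_csubspace_scaleC)

lemma bops_comp:
  assumes "X \<in> bops K L" "Y \<in> bops H K"
  shows "X \<circ> Y \<in> bops H L"
  using assms linear_0[OF bounded_clinear_linear[OF bops_bounded_clinear[OF assms(1)]]]
  by (auto simp: bops_def bounded_clinear_compose)

lemma bops_UNIV: "bops UNIV UNIV = {X :: 'a::chilbert_space \<Rightarrow> 'b::chilbert_space. bounded_clinear X}"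
proof -
  have "orth_compl UNIV = {0 :: 'a}"
  proof safe
    show "x = 0" if "x \<in> orth_compl UNIV" for x :: 'a
    proof -
      have "cinner x x = 0"
        using that by (simp add: orth_compl_def)
      then show ?thesis
        by simp
    qed
  qed (simp add: orth_compl_def)
  moreover have "bounded_clinear X \<Longrightarrow> X 0 = 0" for X :: "'a \<Rightarrow> 'b"
    by (rule linear_0[OF bounded_clinear_linear])
  ultimately show ?thesis
    by (auto simp: bops_def)
qed

text \<open>These closed subspaces bound the hulls defining \<open>F_infty\<close>,
  \<open>W_alg\<close> and \<open>W_tensor_B\<close> from above once they contain the generators.
  Separate \<open>S\<close> and \<open>T\<close> allow the domain and codomain to differ.\<close>

definition intertwiners ::
    "'a::chilbert_space set \<Rightarrow> 'b::chilbert_space set \<Rightarrow> ('a \<Rightarrow> 'a) \<Rightarrow> ('b \<Rightarrow> 'b) \<Rightarrow> ('a \<Rightarrow> 'b) set" where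
  "intertwiners H K S T = {X \<in> bops H K. \<forall>x. X (S x) = T (X x)}"

lemma op_subspace_intertwiners:
  assumes "closed_csubspace K" "bounded_clinear T"
  shows "op_subspace (intertwiners H K S T)"
  using op_subspace_bops[OF assms(1), of H] assms(2) bounded_clinear_linear[OF assms(2)]
  by (auto simp: op_subspace_def intertwiners_def linear_0 linear_add bounded_clinear_scaleC)

lemma op_algebra_intertwiners:
  assumes "closed_csubspace H" "bounded_clinear S"
  shows "op_algebra (intertwiners H H S S)"
  using op_subspace_intertwiners[OF assms] bops_comp by (auto simp: op_algebra_def intertwiners_def)

lemma closed_coordinates_eq:
  "closed {F :: 'i \<Rightarrow> complex. \<forall>p\<in>Q. F (f p) = F (g p)}"
proof -
  have "closed {F :: 'i \<Rightarrow> complex. F (f p) = F (g p)}" for p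
    by (intro closed_Collect_eq continuous_on_product_coordinates)
  then have "closed (\<Inter>p\<in>Q. {F :: 'i \<Rightarrow> complex. F (f p) = F (g p)})"
    by (intro closed_INT) auto
  moreover have "(\<Inter>p\<in>Q. {F :: 'i \<Rightarrow> complex. F (f p) = F (g p)}) = {F. \<forall>p\<in>Q. F (f p) = F (g p)}"
    by auto
  ultimately show ?thesis
    by simp
qed

text \<open>With the adjoint of \<open>T\<close> moved to the other side, the intertwining relation
  equates two coordinates of the function of matrix coefficients, and coordinates are
  continuous.\<close>

lemma
  assumes T: "bounded_clinear T"
  shows closedin_wot_intertwiners:
      "closedin (wot H K) (intertwiners H K S T :: ('a::chilbert_space \<Rightarrow> 'b::chilbert_space) set)"
    and closedin_weak_star_intertwiners: "closedin (weak_star H K) (intertwiners H K S T)"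
proof -
  obtain T' where T': "\<And>x y. cinner y (T x) = cinner (T' y) x"
    using ex_adjoint[OF T] by metis
  have eq: "(\<forall>x. X (S x) = T (X x)) \<longleftrightarrow> (\<forall>x y. cinner y (X (S x)) = cinner (T' y) (X x))" for X
    unfolding T'[symmetric] by (metis cinner_ext)
  let ?C = "{F :: 'a \<times> 'b \<Rightarrow> complex. \<forall>p\<in>UNIV. F ((\<lambda>(x, y). (S x, y)) p) = F ((\<lambda>(x, y). (x, T' y)) p)}"
  show "closedin (wot H K) (intertwiners H K S T)"
    unfolding wot_def closedin_pullback_topology_iff
  proof (intro exI conjI)
    show "closed ?C"
      by (rule closed_coordinates_eq)
    show "intertwiners H K S T = (\<lambda>T (x, y). cinner y (T x)) -` ?C \<inter> bops H K"
      by (auto simp: intertwiners_def eq)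
  qed
  \<comment> \<open>Sequences supported at index 0 recover the plain matrix coefficients among the
    weak-star functionals.\<close>
  have single: "(\<Sum>\<^sub>\<infinity>k. cinner (ell2_nth (ell2_single (0::nat) y) k) (X (ell2_nth (ell2_single 0 x) k)))
      = cinner y (X x)" for x y and X :: "'a \<Rightarrow> 'b"
    by (subst infsum_single[of 0]) (auto simp: ell2_single.rep_eq)
  let ?D = "{F :: (nat, 'a) ell2 \<times> (nat, 'b) ell2 \<Rightarrow> complex. \<forall>p\<in>UNIV. F ((\<lambda>(x, y). (ell2_single (0::nat) (S x), ell2_single (0::nat) y)) p)
    = F ((\<lambda>(x, y). (ell2_single 0 x, ell2_single 0 (T' y))) p)}"
  show "closedin (weak_star H K) (intertwiners H K S T)"
    unfolding weak_star_def closedin_pullback_topology_iff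
  proof (intro exI conjI)
    show "closed ?D"
      by (rule closed_coordinates_eq)
    show "intertwiners H K S T = (\<lambda>T (x, y). \<Sum>\<^sub>\<infinity>k. cinner (ell2_nth y k) (T (ell2_nth x k))) -` ?D \<inter> bops H K"
      by (auto simp: intertwiners_def eq single)
  qed
qed


section \<open>Constrained creation operators\<close>

lemma closed_csubspace_M_space: "closed_csubspace (M_space J)"
  unfolding M_space_def by (rule closed_csubspace_closed_cspan)

lemma closed_csubspace_N_space: "closed_csubspace (N_space J)"
  unfolding N_space_def by (rule closed_csubspace_orth_compl)

lemma bounded_clinear_proj_N: "bounded_clinear (proj (N_space J))"
  by (rule bounded_clinear_proj[OF closed_csubspace_N_space])

lemma orth_compl_N_space: "orth_compl (N_space J) = M_space J"
  unfolding N_space_def by (rule orth_compl_orth_compl[OF closed_csubspace_M_space])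

lemma proj_proj: "closed_csubspace H \<Longrightarrow> proj H (proj H x) = proj H x"
  by (rule proj_ident[OF _ proj_in])

lemma left_creation_in_F_infty: "left_creation i \<in> F_infty"
  unfolding F_infty_def by (rule hull_inc) simp

text \<open>The commutant of a right creation is a WOT-closed algebra containing the identity and
  all left creations.\<close>

lemma F_infty_right_creation_commute:
  assumes "A \<in> F_infty"
  shows "A (right_creation j x) = right_creation j (A x)"
proof -
  let ?C = "intertwiners UNIV UNIV (right_creation j) (right_creation j)"
  have "F_infty \<subseteq> ?C"
    unfolding F_infty_def
  proof (rule hull_minimal)
    show "insert id (range left_creation) \<subseteq> ?C"
      by (auto simp: intertwiners_def bops_UNIV bounded_clinear_id bounded_clinear_left_creation
          left_right_creation_commute)
    show "op_algebra ?C \<and> closedin (wot UNIV UNIV) ?C"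
      by (simp add: op_algebra_intertwiners closed_csubspace_UNIV bounded_clinear_right_creation
          closedin_wot_intertwiners)
  qed
  then show ?thesis
    using assms by (auto simp: intertwiners_def)
qed

lemma compression_in_bops:
  assumes H: "closed_csubspace H" and "bounded_clinear T"
  shows "compression H T \<in> bops H H"
  using linear_0[OF bounded_clinear_linear[OF assms(2)]]
    linear_0[OF bounded_clinear_linear[OF bounded_clinear_proj[OF H]]]
  by (auto simp: bops_def compression_def proj_in[OF H]
      proj_orth_compl[OF H]
      intro!: bounded_clinear_compose bounded_clinear_proj[OF H] assms)

lemma tensor_op_in_bops:
  assumes A: "A \<in> bops H H" and T: "T \<in> bops G K"
    and N: "closed_csubspace H" and G: "closed_csubspace G" and K: "closed_csubspace K"
  shows "tensor_op A T \<in> bops (tensor_space H G) (tensor_space H K)"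
proof -
  note b = bops_bounded_clinear[OF A] bops_bounded_clinear[OF T]
  note bX = bounded_clinear_tensor_op[OF b]
  have "tensor_op A T x \<in> tensor_space H K" for x
    using elementary_tensor_dense[OF closed_csubspace_vimage[OF bX closed_csubspace_tensor_space[OF N K]], of x]
    by (simp add: tensor_op_elementary b elementary_in_tensor_space[OF N K] bops_range[OF A] bops_range[OF T])
  moreover have "tensor_op A T x = 0" if "x \<in> orth_compl (tensor_space H G)" for x
  proof -
    \<comment> \<open>Vanishing on the complement is obtained by factoring through the projection
      onto the tensor space, which is the tensor product of these two projections.\<close>
    have "A \<circ> proj H = A" "T \<circ> proj G = T"
    proof -
      have "X (proj F y) = X y" if "X \<in> bops F L" "closed_csubspace F" for X F y and L :: "'z::chilbert_space set"
        using bops_orth[OF that(1) proj_orth[OF that(2), of y]]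
        by (simp add: linear_diff[OF bounded_clinear_linear[OF bops_bounded_clinear[OF that(1)]]])
      then show "A \<circ> proj H = A" "T \<circ> proj G = T"
        using A T G N by (auto simp: fun_eq_iff)
    qed
    then have "tensor_op A T x = tensor_op A T (proj (tensor_space H G) x)"
      by (simp add: proj_tensor_space[OF N G] tensor_op_compose b bounded_clinear_proj N G)
    also have "proj (tensor_space H G) x = 0"
      by (rule proj_orth_compl[OF closed_csubspace_tensor_space[OF N G] that])
    finally show ?thesis
      by (simp add: linear_0[OF bounded_clinear_linear[OF bX]])
  qed
  ultimately show ?thesis
    using bX by (auto simp: bops_def)
qed

lemma J_range_in_M_space: "A \<in> J \<Longrightarrow> A \<phi> \<in> M_space J"
  unfolding M_space_def using closed_cspan_superset by (rule subsetD) auto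

lemma bounded_clinear_constr_left: "bounded_clinear (constr_left J i)"
  using compression_in_bops[OF closed_csubspace_N_space bounded_clinear_left_creation] by (auto simp: constr_left_def bops_def)

lemma W_alg_comp: "A \<in> W_alg J \<Longrightarrow> B \<in> W_alg J \<Longrightarrow> A \<circ> B \<in> W_alg J"
  unfolding W_alg_def hull_def by (auto simp: op_algebra_def)

context
  fixes J :: "('n::finite fock \<Rightarrow> 'n fock) set"
  assumes J: "wot_closed_ideal J"
begin

lemma proj_N_absorb:
  assumes T: "bounded_clinear T" and inv: "\<And>A \<phi>. A \<in> J \<Longrightarrow> T (A \<phi>) \<in> M_space J"
  shows "proj (N_space J) (T (proj (N_space J) x)) = proj (N_space J) (T x)"
proof -
  have "M_space J \<subseteq> {x. T x \<in> M_space J}"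
    by (subst M_space_def, rule closed_cspan_minimal[OF _ closed_csubspace_vimage[OF T closed_csubspace_M_space]])
      (use inv in auto)
  moreover have "x - proj (N_space J) x \<in> M_space J"
    using proj_orth[OF closed_csubspace_N_space, of x J] by (simp add: orth_compl_N_space)
  ultimately have "T (x - proj (N_space J) x) \<in> orth_compl (N_space J)"
    by (auto simp: orth_compl_N_space)
  then have "proj (N_space J) (T (x - proj (N_space J) x)) = 0"
    by (rule proj_orth_compl[OF closed_csubspace_N_space])
  then show ?thesis
    by (simp add: linear_diff[OF bounded_clinear_linear[OF T]]
        linear_diff[OF bounded_clinear_linear[OF bounded_clinear_proj_N]])
qed

lemma proj_N_left_creation:
  "proj (N_space J) (left_creation i (proj (N_space J) x)) = proj (N_space J) (left_creation i x)"
proof (rule proj_N_absorb[OF bounded_clinear_left_creation])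
  fix A \<phi> assume "A \<in> J"
  then have "left_creation i \<circ> A \<in> J"
    using J left_creation_in_F_infty by (auto simp: wot_closed_ideal_def)
  from J_range_in_M_space[OF this, of \<phi>] show "left_creation i (A \<phi>) \<in> M_space J"
    by simp
qed

lemma proj_N_right_creation:
  "proj (N_space J) (right_creation i (proj (N_space J) x)) = proj (N_space J) (right_creation i x)"
proof (rule proj_N_absorb[OF bounded_clinear_right_creation])
  fix A \<phi> assume A: "A \<in> J"
  then have "A \<in> F_infty"
    using J by (auto simp: wot_closed_ideal_def)
  then show "right_creation i (A \<phi>) \<in> M_space J"
    using J_range_in_M_space[OF A, of "right_creation i \<phi>"] by (simp add: F_infty_right_creation_commute)
qed

lemma proj_N_rcreate_word:
  "proj (N_space J) (rcreate_word u (proj (N_space J) x)) = proj (N_space J) (rcreate_word u x)"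
proof (induction u arbitrary: x)
  case (Cons i u)
  have "proj (N_space J) (rcreate_word u (right_creation i (proj (N_space J) x)))
      = proj (N_space J) (rcreate_word u (proj (N_space J) (right_creation i (proj (N_space J) x))))"
    by (simp add: Cons)
  also have "\<dots> = proj (N_space J) (rcreate_word u (right_creation i x))"
    by (simp add: proj_N_right_creation Cons)
  finally show ?case
    by simp
qed (simp add: proj_proj closed_csubspace_N_space)

lemma compression_rcreate_word_in_W_alg: "compression (N_space J) (rcreate_word u) \<in> W_alg J"
proof (induction u)
  case Nil
  have "compression (N_space J) (rcreate_word []) = proj (N_space J)"
    by (auto simp: compression_def proj_proj closed_csubspace_N_space)
  moreover have "proj (N_space J) \<in> W_alg J"
    unfolding W_alg_def by (rule hull_inc) simp
  ultimately show ?case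
    by metis
next
  case (Cons i u)
  have W: "constr_right J i \<in> W_alg J"
    unfolding W_alg_def by (rule hull_inc) simp
  have "compression (N_space J) (rcreate_word (i # u)) = compression (N_space J) (rcreate_word u) \<circ> constr_right J i"
  proof
    fix x
    show "compression (N_space J) (rcreate_word (i # u)) x = (compression (N_space J) (rcreate_word u) \<circ> constr_right J i) x"
      by (simp add: compression_def constr_right_def proj_N_rcreate_word
          proj_proj closed_csubspace_N_space)
  qed
  then show ?case
    using W_alg_comp[OF Cons W] by metis
qed

text \<open>Left and right creations commute, and absorption carries this over to their
  compressions. The commutant of $B_i$ is then a weak-star closed algebra containing the
  generators.\<close>

lemma W_alg_intertwines:
  assumes "A \<in> W_alg J"
  shows "A \<in> intertwiners (N_space J) (N_space J) (constr_left J i) (constr_left J i)"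
proof -
  let ?C = "intertwiners (N_space J) (N_space J) (constr_left J i) (constr_left J i)"
  have "W_alg J \<subseteq> ?C"
    unfolding W_alg_def
  proof (rule hull_minimal)
    have "proj (N_space J) \<in> bops (N_space J) (N_space J)"
      using compression_in_bops[OF closed_csubspace_N_space bounded_clinear_id(1)]
      by (simp add: compression_def o_def proj_proj closed_csubspace_N_space)
    moreover have "constr_right J j (constr_left J i x) = constr_left J i (constr_right J j x)" for j x
      by (simp add: constr_right_def constr_left_def compression_def proj_N_right_creation
          proj_N_left_creation left_right_creation_commute proj_proj closed_csubspace_N_space)
    ultimately show "insert (proj (N_space J)) (range (constr_right J)) \<subseteq> ?C"
      by (auto simp: intertwiners_def constr_right_def constr_left_def compression_def[of _ "left_creation i"]
          proj_proj closed_csubspace_N_space compression_in_bops bounded_clinear_right_creation)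
    show "op_algebra ?C \<and> closedin (weak_star (N_space J) (N_space J)) ?C"
      by (simp add: op_algebra_intertwiners closed_csubspace_N_space bounded_clinear_constr_left
          closedin_weak_star_intertwiners)
  qed
  then show ?thesis
    using assms by blast
qed

lemma W_tensor_B_intertwines:
  assumes G: "closed_csubspace G" and K: "closed_csubspace K" and X: "X \<in> W_tensor_B J G K"
  shows "X (tensor_op (constr_left J i) id x) = tensor_op (constr_left J i) id (X x)"
proof -
  note b = bounded_clinear_tensor_op[OF bounded_clinear_constr_left bounded_clinear_id(1)]
  note N = closed_csubspace_N_space[of J]
  let ?C = "intertwiners (tensor_space (N_space J) G) (tensor_space (N_space J) K)
    (tensor_op (constr_left J i) id) (tensor_op (constr_left J i) id)"
  have "W_tensor_B J G K \<subseteq> ?C"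
    unfolding W_tensor_B_def
  proof (rule hull_minimal)
    show "{tensor_op A T |A T. A \<in> W_alg J \<and> T \<in> bops G K} \<subseteq> ?C"
    proof safe
      fix A and T :: "'a \<Rightarrow> 'b" assume A: "A \<in> W_alg J" and T: "T \<in> bops G K"
      from W_alg_intertwines[OF A, of i]
      have A': "A \<in> bops (N_space J) (N_space J)" "A \<circ> constr_left J i = constr_left J i \<circ> A"
        by (auto simp: intertwiners_def)
      show "tensor_op A T \<in> ?C"
        unfolding intertwiners_def
        using tensor_op_in_bops[OF A'(1) T N G K] bops_bounded_clinear[OF A'(1)] bops_bounded_clinear[OF T]
        by (simp add: tensor_op_compose bounded_clinear_constr_left bounded_clinear_id A'(2))
    qed
    show "op_subspace ?C \<and> closedin (wot (tensor_space (N_space J) G) (tensor_space (N_space J) K)) ?C"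
      by (simp add: op_subspace_intertwiners closedin_wot_intertwiners b closed_csubspace_tensor_space N K)
  qed
  then show ?thesis
    using X by (auto simp: intertwiners_def)
qed

lemma inner_operator_image_invariant:
  assumes G: "closed_csubspace G" and \<Theta>: "inner_operator J G UNIV \<Theta>"
    and M: "M = \<Theta> ` tensor_space (N_space J) G"
  shows "tensor_op (constr_left J i) id ` M \<subseteq> M"
proof -
  note b = bounded_clinear_tensor_op[OF bounded_clinear_constr_left bounded_clinear_id(1)]
  note N = closed_csubspace_N_space[of J]
  have range: "constr_left J i \<phi> \<in> N_space J" for \<phi>
    by (simp add: constr_left_def compression_def proj_in[OF N])
  have "tensor_space (N_space J) G \<subseteq> {x. tensor_op (constr_left J i) id x \<in> tensor_space (N_space J) G}"
    by (subst tensor_space_def, rule closed_cspan_minimal[OF _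
          closed_csubspace_vimage[OF b closed_csubspace_tensor_space[OF N G]]])
      (auto simp: tensor_op_elementary bounded_clinear_constr_left bounded_clinear_id
        intro!: elementary_in_tensor_space[OF N G] range)
  then show ?thesis
    using \<Theta> W_tensor_B_intertwines[OF G closed_csubspace_UNIV, of \<Theta> i]
    by (auto simp: M inner_operator_def simp flip: W_tensor_B_intertwines[OF G closed_csubspace_UNIV])
qed

end

section \<open>The isometry attached to a wandering subspace\<close>

primrec lcreate_word :: "'n list \<Rightarrow> ('n list, 'k::chilbert_space) ell2 \<Rightarrow> ('n list, 'k) ell2" where
  "lcreate_word [] x = x"
| "lcreate_word (i # w) x = lcreate i (lcreate_word w x)"

lemma lcreate_word_nth:
  "ell2_nth (lcreate_word w x) v = (if take (length w) v = w then ell2_nth x (drop (length w) v) else 0)"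
proof (induction w arbitrary: v)
  case (Cons i w)
  then show ?case
    by (cases v) auto
qed simp

text \<open>Truncation to the degrees in $(t-m,t]$, with the lower bound written as an addition
  because subtraction on naturals truncates.\<close>

lift_definition window :: "nat \<Rightarrow> nat \<Rightarrow> ('n list, 'k::chilbert_space) ell2 \<Rightarrow> ('n list, 'k) ell2"
  is "\<lambda>m t x w. if length w \<le> t \<and> t < length w + m then x w else 0"
  by (erule square_summable_dominated[where C = 1]) simp

text \<open>A word \<open>w\<close> is kept exactly for the \<open>m\<close> values of
  \<open>t\<close> from \<open>length w\<close> to \<open>length w + m - 1\<close>.\<close>

lemma sum_norm_window_le: "(\<Sum>t<L. (norm (window m t x))\<^sup>2) \<le> real m * (norm x)\<^sup>2"
proof (rule has_sum_mono)
  show "((\<lambda>w. \<Sum>t<L. (norm (ell2_nth (window m t x) w))\<^sup>2) has_sum (\<Sum>t<L. (norm (window m t x))\<^sup>2)) UNIV"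
    by (intro has_sum_sum has_sum_ell2_norm)
  show "((\<lambda>w. real m * (norm (ell2_nth x w))\<^sup>2) has_sum real m * (norm x)\<^sup>2) UNIV"
    by (intro has_sum_cmult_right has_sum_ell2_norm)
  fix w
  have "(\<Sum>t<L. (norm (ell2_nth (window m t x) w))\<^sup>2)
      = (\<Sum>t\<in>{..<L} \<inter> {length w..<length w + m}. (norm (ell2_nth x w))\<^sup>2)"
    by (rule sum.mono_neutral_cong_right) (auto simp: window.rep_eq)
  also have "\<dots> \<le> (\<Sum>t\<in>{length w..<length w + m}. (norm (ell2_nth x w))\<^sup>2)"
    by (rule sum_mono2) auto
  finally show "(\<Sum>t<L. (norm (ell2_nth (window m t x) w))\<^sup>2) \<le> real m * (norm (ell2_nth x w))\<^sup>2"
    by simp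
qed

locale wandering_subspace =
  fixes M G :: "('n::finite list, 'k::chilbert_space) ell2 set"
  assumes closed_M: "closed_csubspace M" and closed_G: "closed_csubspace G"
    and lcreate_M: "x \<in> M \<Longrightarrow> lcreate i x \<in> M"
    and G_subset: "G \<subseteq> M"
    and wandering: "x \<in> M \<Longrightarrow> g \<in> G \<Longrightarrow> cinner (lcreate i x) g = 0"
    and generating: "y \<in> M \<Longrightarrow> (\<And>g. g \<in> G \<Longrightarrow> cinner g y = 0) \<Longrightarrow>
      ell2_nth y [] = 0 \<and> lannih i y \<in> M"
begin

lemma lcreate_word_M: "x \<in> M \<Longrightarrow> lcreate_word w x \<in> M"
  by (induction w) (auto intro: lcreate_M)

text \<open>Common first letters cancel and different ones give orthogonal ranges; when one word is
  exhausted before the other, \<open>wandering\<close> applies.\<close>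

lemma cinner_lcreate_word:
  assumes "g \<in> G" "h \<in> G"
  shows "cinner (lcreate_word w g) (lcreate_word v h) = (if w = v then cinner g h else 0)"
proof (induction w arbitrary: v)
  case Nil
  show ?case
  proof (cases v)
    case (Cons j u)
    have "cinner (lcreate j (lcreate_word u h)) g = 0"
      using assms G_subset by (intro wandering lcreate_word_M) auto
    then show ?thesis
      by (simp add: Cons cinner_eq_0_commute)
  qed simp
next
  case (Cons i w)
  show ?case
  proof (cases v)
    case Nil
    then show ?thesis
      using assms G_subset by (auto intro!: wandering lcreate_word_M)
  next
    case (Cons j u)
    then show ?thesis
      using Cons.IH[of u] by (auto simp: cinner_lcreate_left lannih_lcreate)
  qed
qed

text \<open>The contribution to the coordinate of \<open>V x\<close> at \<open>v\<close> that comes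
  from the prefix of length \<open>k\<close>.\<close>

abbreviation coefficient :: "('n list, ('n list, 'k) ell2) ell2 \<Rightarrow> 'n list \<Rightarrow> nat \<Rightarrow> 'k" where
  "coefficient x v k \<equiv> ell2_nth (proj G (ell2_nth x (take k v))) (drop k v)"

text \<open>The initial projection of \<open>V\<close>: by \<open>cinner_V\<close> the inner
  products of values of \<open>V\<close> are those of the projected vectors.\<close>

abbreviation coefficient_proj :: "('n list, ('n list, 'k) ell2) ell2 \<Rightarrow> ('n list, ('n list, 'k) ell2) ell2" where
  "coefficient_proj \<equiv> tensor_op id (proj G)"

text \<open>The words in \<open>F\<close> have only finitely many prefixes. On \<open>F\<close> the
  coordinates agree with those of the finite sum of translates over these prefixes, and that sum is
  orthogonal, so Pythagoras bounds it.\<close>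

lemma sum_coefficient_bound:
  assumes F: "finite F"
  shows "(\<Sum>v\<in>F. (norm (\<Sum>k\<le>length v. coefficient x v k))\<^sup>2) \<le> (1 * norm x)\<^sup>2"
proof -
  define W where "W = (\<Union>v\<in>F. (\<lambda>k. take k v) ` {..length v})"
  define a where "a w = lcreate_word w (proj G (ell2_nth x w))" for w
  have W: "finite W"
    using F by (auto simp: W_def)
  have nth: "ell2_nth (sum a W) v = (\<Sum>k\<le>length v. coefficient x v k)" if v: "v \<in> F" for v
  proof -
    have "ell2_nth (sum a W) v = (\<Sum>w\<in>W. if take (length w) v = w
        then ell2_nth (proj G (ell2_nth x w)) (drop (length w) v) else 0)"
      by (simp add: ell2_nth_sum a_def lcreate_word_nth)
    also have "\<dots> = (\<Sum>w\<in>{w \<in> W. take (length w) v = w}. ell2_nth (proj G (ell2_nth x w)) (drop (length w) v))"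
      using W by (simp add: sum.inter_filter)
    also have "{w \<in> W. take (length w) v = w} = (\<lambda>k. take k v) ` {..length v}"
    proof safe
      fix w assume "take (length w) v = w"
      moreover from this have "length w \<le> length v"
        by (metis length_take min.cobounded1)
      ultimately show "w \<in> (\<lambda>k. take k v) ` {..length v}"
        by (intro image_eqI[of _ _ "length w"]) auto
    qed (use v in \<open>auto simp: W_def min_def\<close>)
    also have "(\<Sum>w\<in>(\<lambda>k. take k v) ` {..length v}. ell2_nth (proj G (ell2_nth x w)) (drop (length w) v))
        = (\<Sum>k\<le>length v. coefficient x v k)"
    proof (subst sum.reindex)
      show "inj_on (\<lambda>k. take k v) {..length v}"
        by (rule inj_on_inverseI[of _ length]) (simp add: min_def)
    qed (auto intro!: sum.cong simp: min_def)
    finally show ?thesis .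
  qed
  have "(\<Sum>v\<in>F. (norm (\<Sum>k\<le>length v. coefficient x v k))\<^sup>2) = (\<Sum>v\<in>F. (norm (ell2_nth (sum a W) v))\<^sup>2)"
    by (simp add: nth)
  also have "\<dots> \<le> (norm (sum a W))\<^sup>2"
    by (rule sum_norm_ell2_nth_le[OF F])
  also have "\<dots> = (\<Sum>w\<in>W. (norm (a w))\<^sup>2)"
    by (rule norm_sum_Pythagorean[OF W])
      (auto simp: pairwise_def orthogonal_def inner_eq_Re_cinner a_def cinner_lcreate_word proj_in[OF closed_G])
  also have "\<dots> \<le> (\<Sum>w\<in>W. (norm (ell2_nth x w))\<^sup>2)"
  proof (intro sum_mono power_mono)
    fix w
    have "norm (a w) = norm (proj G (ell2_nth x w))"
      unfolding a_def by (rule norm_eq_if_cinner_eq) (simp add: cinner_lcreate_word proj_in[OF closed_G])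
    then show "norm (a w) \<le> norm (ell2_nth x w)"
      by (simp add: norm_proj_le[OF closed_G])
  qed auto
  also have "\<dots> \<le> (norm x)\<^sup>2"
    by (rule sum_norm_ell2_nth_le[OF W])
  finally show ?thesis
    by simp
qed

text \<open>\<open>V\<close> maps $e_w\otimes g$ to $(S_w\otimes I)g$ for \<open>g \<in> G\<close>; since a word has only finitely many
  prefixes, its coordinates are finite sums.\<close>

definition V :: "('n list, ('n list, 'k) ell2) ell2 \<Rightarrow> ('n list, 'k) ell2" where
  "V = (SOME V. bounded_clinear V \<and> (\<forall>x v. ell2_nth (V x) v = (\<Sum>k\<le>length v. coefficient x v k)) \<and>
    (\<forall>x. norm (V x) \<le> 1 * norm x))"

lemma
  shows bounded_clinear_V: "bounded_clinear V"
    and V_nth: "ell2_nth (V x) v = (\<Sum>k\<le>length v. coefficient x v k)"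
    and norm_V_le: "norm (V x) \<le> norm x"
proof -
  have nth: "bounded_clinear (\<lambda>x. coefficient x v k)" for v k
    using bounded_clinear_compose[OF bounded_clinear_ell2_nth
        bounded_clinear_compose[OF bounded_clinear_proj[OF closed_G] bounded_clinear_ell2_nth]]
    by (simp add: o_def)
  have lin: "bounded_clinear (\<lambda>x. \<Sum>k\<le>length v. coefficient x v k)" for v
    by (intro bounded_clinear_sum nth)
  have "\<exists>V. bounded_clinear V \<and> (\<forall>x v. ell2_nth (V x) v = (\<Sum>k\<le>length v. coefficient x v k)) \<and>
    (\<forall>x. norm (V x) \<le> 1 * norm x)"
    using linear_add[OF bounded_clinear_linear[OF lin]] bounded_clinear_scaleC[OF lin] sum_coefficient_bound
    by (rule bounded_clinear_ell2I) simp_all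
  from someI_ex[OF this] show "bounded_clinear V" "ell2_nth (V x) v = (\<Sum>k\<le>length v. coefficient x v k)"
    "norm (V x) \<le> norm x"
    unfolding V_def[symmetric] by auto
qed

lemma V_single: "V (ell2_single w g) = lcreate_word w (proj G g)"
proof (rule ell2_eqI)
  fix v
  have take_eq: "take k v = w \<longleftrightarrow> k = length w \<and> take (length w) v = w" if "k \<le> length v" for k
    using that by auto
  have "ell2_nth (V (ell2_single w g)) v
      = (\<Sum>k\<le>length v. if k = length w then ell2_nth (lcreate_word w (proj G g)) v else 0)"
    unfolding V_nth
  proof (intro sum.cong refl)
    fix k assume "k \<in> {..length v}"
    then show "coefficient (ell2_single w g) v k = (if k = length w then ell2_nth (lcreate_word w (proj G g)) v else 0)"
      using take_eq[of k] linear_0[OF bounded_clinear_linear[OF bounded_clinear_proj[OF closed_G]]]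
      by (auto simp: ell2_single.rep_eq lcreate_word_nth zero_ell2.rep_eq)
  qed
  also have "\<dots> = ell2_nth (lcreate_word w (proj G g)) v"
  proof (cases "length w \<le> length v")
    case False
    then have "take (length w) v \<noteq> w"
      by auto
    then show ?thesis
      using False by (simp add: lcreate_word_nth)
  qed simp
  finally show "ell2_nth (V (ell2_single w g)) v = ell2_nth (lcreate_word w (proj G g)) v" .
qed

lemma bounded_clinear_coefficient_proj: "bounded_clinear coefficient_proj"
  by (rule bounded_clinear_tensor_op[OF bounded_clinear_id(1) bounded_clinear_proj[OF closed_G]])

lemma coefficient_proj_nth: "ell2_nth (coefficient_proj x) w = proj G (ell2_nth x w)"
  by (rule tensor_op_id_left[OF bounded_clinear_proj[OF closed_G]])

lemma V_coefficient_proj: "V (coefficient_proj x) = V x"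
  by (rule ell2_eqI) (simp add: V_nth coefficient_proj_nth proj_proj closed_G)

lemma coefficient_proj_single: "coefficient_proj (ell2_single w g) = ell2_single w (proj G g)"
  using linear_0[OF bounded_clinear_linear[OF bounded_clinear_proj[OF closed_G]]]
  by (auto intro!: ell2_eqI simp: coefficient_proj_nth ell2_single.rep_eq)

text \<open>On one-coordinate vectors this is the orthogonality of the translates of
  \<open>G\<close>; density extends it in one variable at a time.\<close>

lemma cinner_V: "cinner (V x) (V y) = cinner (coefficient_proj x) (coefficient_proj y)"
proof -
  have fV: "bounded_clinear (\<lambda>y. cinner z (V y))" for z
    using bounded_clinear_compose[OF bounded_clinear_cinner_right bounded_clinear_V] by (simp add: o_def)
  have fQ: "bounded_clinear (\<lambda>y. cinner z (coefficient_proj y))" for z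
    using bounded_clinear_compose[OF bounded_clinear_cinner_right bounded_clinear_coefficient_proj]
    by (simp add: o_def)
  have "cinner (V (ell2_single w g)) (V y) = cinner (coefficient_proj (ell2_single w g)) (coefficient_proj y)"
    for w g y
  proof (rule bounded_clinear_eqI_single[OF fV fQ])
    show "cinner (V (ell2_single w g)) (V (ell2_single v h))
      = cinner (coefficient_proj (ell2_single w g)) (coefficient_proj (ell2_single v h))" for v h
      by (simp add: V_single coefficient_proj_single cinner_lcreate_word proj_in[OF closed_G]
          cinner_ell2_single ell2_single.rep_eq)
  qed
  then have "cinner (V y) (V (ell2_single w g)) = cinner (coefficient_proj y) (coefficient_proj (ell2_single w g))"
    for w g y
    by (metis cinner_commute)
  from bounded_clinear_eqI_single[OF fV[of "V x"] fQ[of "coefficient_proj x"] this] show ?thesis .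
qed

lemma norm_V: "norm (V x) = norm (coefficient_proj x)"
  by (rule norm_eq_if_cinner_eq) (rule cinner_V)

lemma closed_csubspace_range_V: "closed_csubspace (range V)"
proof -
  note lin = bounded_clinear_linear[OF bounded_clinear_V]
  have "closed (range V)"
    unfolding closed_sequential_limits
  proof (intro allI impI, elim conjE)
    fix f y assume "\<forall>n. f n \<in> range V" and lim: "f \<longlonglongrightarrow> y"
    then have "\<forall>n. \<exists>z. f n = V z"
      by blast
    from choice[OF this] obtain x where x: "\<And>n. f n = V (x n)"
      by blast
    \<comment> \<open>The preimages themselves need not be Cauchy, since \<open>V\<close> has a
      kernel; their projections are, and they have the same images.\<close>
    have "dist (coefficient_proj (x m)) (coefficient_proj (x n)) = dist (f m) (f n)" for m n
      using norm_V[of "x m - x n"]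
      by (simp add: dist_norm x linear_diff[OF lin]
          linear_diff[OF bounded_clinear_linear[OF bounded_clinear_coefficient_proj]])
    then have "Cauchy (\<lambda>n. coefficient_proj (x n))"
      using LIMSEQ_imp_Cauchy[OF lim] by (simp add: Cauchy_def)
    then obtain z where "(\<lambda>n. coefficient_proj (x n)) \<longlonglongrightarrow> z"
      using Cauchy_convergent convergent_def by blast
    then have "(\<lambda>n. V (coefficient_proj (x n))) \<longlonglongrightarrow> V z"
      by (rule bounded_linear.tendsto[OF bounded_clinear_imp_bounded_linear[OF bounded_clinear_V]])
    then have "f \<longlonglongrightarrow> V z"
      by (simp add: V_coefficient_proj flip: x)
    then show "y \<in> range V"
      using lim LIMSEQ_unique by blast
  qed
  moreover have "0 \<in> range V"
    using linear_0[OF lin] by (metis rangeI)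
  moreover have "V x + V y \<in> range V" for x y
    by (simp flip: linear_add[OF lin])
  moreover have "c *\<^sub>C V x \<in> range V" for c x
    by (simp flip: bounded_clinear_scaleC[OF bounded_clinear_V])
  ultimately show ?thesis
    by (auto simp: closed_csubspace_def)
qed

text \<open>Orthogonality to \<open>G\<close> allows the first letter to be stripped without leaving
  \<open>M\<close>, and the result is again orthogonal to all translates. After
  \<open>length v\<close> steps the coordinate at \<open>v\<close> has become the vacuum coordinate,
  which is zero.\<close>

lemma nth_eq_0_if_orthogonal:
  assumes "y \<in> M" and "\<And>w g. g \<in> G \<Longrightarrow> cinner (lcreate_word w g) y = 0"
  shows "ell2_nth y v = 0"
  using assms
proof (induction v arbitrary: y)
  case Nil
  then show ?case
    using generating[of y] Nil(2)[of _ "[]"] by simp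
next
  case (Cons i v)
  have "lannih i y \<in> M"
    using generating[of y i] Cons.prems(1) Cons.prems(2)[of _ "[]"] by simp
  moreover have "cinner (lcreate_word w g) (lannih i y) = 0" if "g \<in> G" for w g
    using Cons.prems(2)[OF that, of "i # w"] by (simp add: cinner_lcreate_left)
  ultimately have "ell2_nth (lannih i y) v = 0"
    by (rule Cons.IH)
  then show ?case
    by (simp add: lannih.rep_eq)
qed

lemma range_V: "range V = M"
proof
  have "V x \<in> M" for x
    using ell2_single_dense[OF closed_csubspace_vimage[OF bounded_clinear_V closed_M], of x]
      proj_in[OF closed_G] G_subset by (auto simp: V_single intro!: lcreate_word_M)
  then show "range V \<subseteq> M"
    by blast
  show "M \<subseteq> range V"
  proof
    fix x assume x: "x \<in> M"
    define y where "y = x - proj (range V) x"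
    have "proj (range V) x \<in> M"
      using proj_in[OF closed_csubspace_range_V] \<open>range V \<subseteq> M\<close> by blast
    then have "y \<in> M"
      unfolding y_def using x closed_csubspace_diff[OF closed_M] by blast
    moreover have "cinner (lcreate_word w g) y = 0" if "g \<in> G" for w g
    proof -
      have "lcreate_word w g = V (ell2_single w g)"
        using that by (simp add: V_single proj_ident[OF closed_G])
      then have "lcreate_word w g \<in> range V"
        by simp
      then show ?thesis
        unfolding y_def by (rule cinner_proj_orth[OF closed_csubspace_range_V])
    qed
    ultimately have "ell2_nth y v = 0" for v
      by (rule nth_eq_0_if_orthogonal)
    then have "y = 0"
      by (intro ell2_eqI) (simp add: zero_ell2.rep_eq)
    then show "x \<in> range V"
      using proj_in[OF closed_csubspace_range_V, of x] by (simp add: y_def)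
  qed
qed


subsection \<open>Cesaro means\<close>

definition symbol :: "'n list \<Rightarrow> ('n list, 'k) ell2 \<Rightarrow> 'k" where
  "symbol u g = ell2_nth (proj G g) u"

text \<open>The summand at \<open>u\<close> is a multiple of $R_u\otimes T_u$, where $V=\sum_u R_u\otimes T_u$ formally.\<close>

definition cesaro :: "nat \<Rightarrow> ('n list, ('n list, 'k) ell2) ell2 \<Rightarrow> ('n list, 'k) ell2" where
  "cesaro m x = (\<Sum>u | length u < m. complex_of_real (real (m - length u) / real m) *\<^sub>C
    tensor_op (rcreate_word u) (symbol u) x)"

lemma symbol_in_bops: "symbol u \<in> bops G UNIV"
  using bounded_clinear_compose[OF bounded_clinear_ell2_nth bounded_clinear_proj[OF closed_G]]
  by (auto simp: bops_def symbol_def[abs_def] o_def proj_orth_compl[OF closed_G] zero_ell2.rep_eq)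

lemma bounded_clinear_symbol: "bounded_clinear (symbol u)"
  by (rule bops_bounded_clinear[OF symbol_in_bops])

lemma finite_words: "finite {u :: 'n list. length u < m}"
  by (rule finite_subset[OF _ finite_lists_length_le[of UNIV m]]) auto

text \<open>The suffixes \<open>u\<close> of \<open>v\<close> correspond to the cut points
  \<open>k = length v - length u\<close>. Truncated subtraction makes the weight zero when the
  suffix is too long, so the sum may run over all \<open>k\<close>.\<close>

lemma cesaro_nth:
  "ell2_nth (cesaro m x) v = (\<Sum>k\<le>length v. (real (m - (length v - k)) / real m) *\<^sub>R coefficient x v k)"
proof -
  have "ell2_nth (cesaro m x) v = (\<Sum>u | length u < m. if \<exists>w. v = w @ u
      then (real (m - length u) / real m) *\<^sub>R ell2_nth (proj G (ell2_nth x (take (length v - length u) v))) u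
      else 0)"
    by (auto simp: cesaro_def ell2_nth_sum scaleC_ell2.rep_eq tensor_op_rcreate_word_nth
        bounded_clinear_symbol symbol_def scaleR_scaleC intro!: sum.cong)
  also have "\<dots> = (\<Sum>u\<in>{u \<in> {u. length u < m}. \<exists>w. v = w @ u}. (real (m - length u) / real m) *\<^sub>R
      ell2_nth (proj G (ell2_nth x (take (length v - length u) v))) u)"
    by (rule sum.inter_filter[symmetric, OF finite_words])
  also have "{u \<in> {u. length u < m}. \<exists>w. v = w @ u}
      = (\<lambda>k. drop k v) ` {k \<in> {..length v}. length v - k < m}"
  proof safe
    fix u w assume "v = w @ u" "length u < m"
    then show "u \<in> (\<lambda>k. drop k (w @ u)) ` {k \<in> {..length (w @ u)}. length (w @ u) - k < m}"
      by (intro image_eqI[of _ _ "length w"]) auto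
  qed (auto, metis append_take_drop_id)
  also have "(\<Sum>u\<in>(\<lambda>k. drop k v) ` {k \<in> {..length v}. length v - k < m}. (real (m - length u) / real m) *\<^sub>R
      ell2_nth (proj G (ell2_nth x (take (length v - length u) v))) u)
      = (\<Sum>k\<in>{k \<in> {..length v}. length v - k < m}. (real (m - (length v - k)) / real m) *\<^sub>R coefficient x v k)"
  proof (subst sum.reindex)
    show "inj_on (\<lambda>k. drop k v) {k \<in> {..length v}. length v - k < m}"
      by (rule inj_on_inverseI[of _ "\<lambda>u. length v - length u"]) simp
  qed (auto intro!: sum.cong)
  also have "\<dots> = (\<Sum>k\<le>length v. (real (m - (length v - k)) / real m) *\<^sub>R coefficient x v k)"
    by (rule sum.mono_neutral_left) auto
  finally show ?thesis .
qed

text \<open>$m$ times the Cesaro mean is the sum of the corners of \<open>V\<close> cut out by the degree windows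
  $(t-m,t]$.\<close>

lemma cesaro_eq_sum_window:
  assumes "0 < m"
  shows "real m *\<^sub>R ell2_nth (cesaro m x) v = (\<Sum>t=length v..<length v + m. ell2_nth (V (window m t x)) v)"
proof -
  have c: "coefficient (window m t x) v k = (if k \<le> t \<and> t < k + m then coefficient x v k else 0)"
    if "k \<le> length v" for k t
    using that linear_0[OF bounded_clinear_linear[OF bounded_clinear_proj[OF closed_G]]]
    by (auto simp: window.rep_eq min_def zero_ell2.rep_eq)
  have "(\<Sum>t=length v..<length v + m. ell2_nth (V (window m t x)) v)
      = (\<Sum>t=length v..<length v + m. \<Sum>k\<le>length v. if k \<le> t \<and> t < k + m then coefficient x v k else 0)"
    by (simp add: V_nth c)
  also have "\<dots> = (\<Sum>k\<le>length v. \<Sum>t=length v..<length v + m. if k \<le> t \<and> t < k + m then coefficient x v k else 0)"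
    by (rule sum.swap)
  also have "\<dots> = (\<Sum>k\<le>length v. real (m - (length v - k)) *\<^sub>R coefficient x v k)"
  proof (intro sum.cong refl)
    fix k assume "k \<in> {..length v}"
    \<comment> \<open>Since \<open>k \<le> length v \<le> t\<close>, only \<open>t < k + m\<close>
      remains as a restriction. The count of such \<open>t\<close> truncates to zero when
      \<open>k + m\<close> does not exceed \<open>length v\<close>.\<close>
    then have "(\<Sum>t=length v..<length v + m. if k \<le> t \<and> t < k + m then coefficient x v k else 0)
        = (\<Sum>t=length v..<k + m. coefficient x v k)"
      by (intro sum.mono_neutral_cong_right) auto
    also have "\<dots> = real (k + m - length v) *\<^sub>R coefficient x v k"
      by (simp add: sum_constant_scaleR)
    also have "k + m - length v = m - (length v - k)"
      using \<open>k \<in> {..length v}\<close> by simp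
    finally show "(\<Sum>t=length v..<length v + m. if k \<le> t \<and> t < k + m then coefficient x v k else 0)
        = real (m - (length v - k)) *\<^sub>R coefficient x v k" .
  qed
  finally show ?thesis
    using assms by (simp add: cesaro_nth scaleR_sum_right)
qed

text \<open>Cauchy-Schwarz over the \<open>m\<close> values of \<open>t\<close> costs one factor
  \<open>m\<close>, and the overlap of the windows costs another. Together they match the factor
  $m^2$ on the left.\<close>

lemma norm_cesaro_le:
  assumes m: "0 < m"
  shows "norm (cesaro m x) \<le> norm x"
proof (rule norm_ell2_leI)
  fix F :: "'n list set" assume F: "finite F"
  \<comment> \<open>A common upper end for the ranges of \<open>t\<close> attached to all words in
    \<open>F\<close>, so that the two sums can be interchanged.\<close>
  obtain L where L: "\<And>v. v \<in> F \<Longrightarrow> length v + m \<le> L"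
    using F finite_nat_set_iff_bounded_le[of "(\<lambda>v. length v + m) ` F"] by auto
  have "(real m)\<^sup>2 * (\<Sum>v\<in>F. (norm (ell2_nth (cesaro m x) v))\<^sup>2)
      = (\<Sum>v\<in>F. (norm (\<Sum>t=length v..<length v + m. ell2_nth (V (window m t x)) v))\<^sup>2)"
    unfolding cesaro_eq_sum_window[OF m, symmetric] by (simp add: sum_distrib_left power_mult_distrib)
  also have "\<dots> \<le> (\<Sum>v\<in>F. real m * (\<Sum>t<L. (norm (ell2_nth (V (window m t x)) v))\<^sup>2))"
  proof (rule sum_mono)
    fix v assume v: "v \<in> F"
    have "(norm (\<Sum>t=length v..<length v + m. ell2_nth (V (window m t x)) v))\<^sup>2
        \<le> (\<Sum>t=length v..<length v + m. norm (ell2_nth (V (window m t x)) v))\<^sup>2"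
      by (intro power_mono norm_sum) auto
    also have "\<dots> \<le> (\<Sum>t=length v..<length v + m. (norm (ell2_nth (V (window m t x)) v))\<^sup>2) * real m"
      using sum_squared_le_sum_of_squares[of "\<lambda>t. norm (ell2_nth (V (window m t x)) v)" "{length v..<length v + m}"]
      by simp
    also have "\<dots> \<le> (\<Sum>t<L. (norm (ell2_nth (V (window m t x)) v))\<^sup>2) * real m"
      using L[OF v] by (intro mult_right_mono sum_mono2) auto
    finally show "(norm (\<Sum>t=length v..<length v + m. ell2_nth (V (window m t x)) v))\<^sup>2
        \<le> real m * (\<Sum>t<L. (norm (ell2_nth (V (window m t x)) v))\<^sup>2)"
      by (simp add: mult.commute)
  qed
  also have "\<dots> = real m * (\<Sum>t<L. \<Sum>v\<in>F. (norm (ell2_nth (V (window m t x)) v))\<^sup>2)"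
    by (subst sum.swap) (simp add: sum_distrib_left)
  also have "\<dots> \<le> real m * (\<Sum>t<L. (norm (window m t x))\<^sup>2)"
  proof (intro mult_left_mono sum_mono)
    fix t
    have "(\<Sum>v\<in>F. (norm (ell2_nth (V (window m t x)) v))\<^sup>2) \<le> (norm (V (window m t x)))\<^sup>2"
      by (rule sum_norm_ell2_nth_le[OF F])
    also have "\<dots> \<le> (norm (window m t x))\<^sup>2"
      by (intro power_mono norm_V_le) auto
    finally show "(\<Sum>v\<in>F. (norm (ell2_nth (V (window m t x)) v))\<^sup>2) \<le> (norm (window m t x))\<^sup>2" .
  qed auto
  also have "\<dots> \<le> real m * (real m * (norm x)\<^sup>2)"
    by (intro mult_left_mono sum_norm_window_le) auto
  finally show "(\<Sum>v\<in>F. (norm (ell2_nth (cesaro m x) v))\<^sup>2) \<le> (norm x)\<^sup>2"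
    using m by (simp add: power2_eq_square)
qed auto

lemma cesaro_weak_tendsto: "(\<lambda>m. cinner y (cesaro (Suc m) x)) \<longlonglongrightarrow> cinner y (V x)"
proof (rule bounded_coordinatewise_imp_weak_tendsto)
  show "norm (cesaro (Suc m) x) \<le> norm x" for m
    by (rule norm_cesaro_le) simp
  show "(\<lambda>m. ell2_nth (cesaro (Suc m) x) v) \<longlonglongrightarrow> ell2_nth (V x) v" for v
  proof -
    have "(\<lambda>m. real (Suc m - d) / real (Suc m)) \<longlonglongrightarrow> 1" for d
    proof -
      have "(\<lambda>m. 1 - real d * inverse (real (Suc m))) \<longlonglongrightarrow> 1 - real d * 0"
        by (intro tendsto_intros LIMSEQ_inverse_real_of_nat)
      \<comment> \<open>The identity is needed only for large \<open>m\<close>, where the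
        subtraction does not truncate.\<close>
      moreover have "eventually (\<lambda>m. 1 - real d * inverse (real (Suc m)) = real (Suc m - d) / real (Suc m)) sequentially"
        using eventually_ge_at_top[of d] by eventually_elim (simp add: of_nat_diff field_simps)
      ultimately show ?thesis
        using Lim_transform_eventually by fastforce
    qed
    then have "(\<lambda>m. \<Sum>k\<le>length v. (real (Suc m - (length v - k)) / real (Suc m)) *\<^sub>R coefficient x v k)
        \<longlonglongrightarrow> (\<Sum>k\<le>length v. 1 *\<^sub>R coefficient x v k)"
      by (intro tendsto_intros)
    then show ?thesis
      by (simp add: cesaro_nth V_nth)
  qed
qed

end

section \<open>Invariant subspaces\<close>

lemma op_subspace_sum:
  assumes \<X>: "op_subspace \<X>" and f: "\<And>u. u \<in> I \<Longrightarrow> f u \<in> \<X>"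
  shows "(\<lambda>x. \<Sum>u\<in>I. c u *\<^sub>C f u x) \<in> \<X>"
  using f
proof (induction I rule: infinite_finite_induct)
  case (insert u I)
  then have "(\<lambda>x. c u *\<^sub>C f u x) \<in> \<X>" "(\<lambda>x. \<Sum>u\<in>I. c u *\<^sub>C f u x) \<in> \<X>"
    using \<X> by (auto simp: op_subspace_def)
  then show ?case
    using \<X> insert.hyps unfolding op_subspace_def by simp
qed (use \<X> in \<open>auto simp: op_subspace_def\<close>)

lemma proj_UNIV: "proj UNIV = id"
  by (rule ext) (simp add: proj_ident closed_csubspace_UNIV)

locale constrained_invariant_subspace =
  fixes J :: "('n::finite fock \<Rightarrow> 'n fock) set" and M :: "('n list, 'k::chilbert_space) ell2 set"
  assumes J: "wot_closed_ideal J" and M: "closed_csubspace M"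
    and M_subset: "M \<subseteq> tensor_space (N_space J) UNIV"
    and invariant: "tensor_op (constr_left J i) id ` M \<subseteq> M"
begin

abbreviation P :: "('n list, 'k) ell2 \<Rightarrow> ('n list, 'k) ell2" where
  "P \<equiv> tensor_op (proj (N_space J)) id"

lemma P_eq: "P = proj (tensor_space (N_space J) UNIV)"
  by (simp add: proj_tensor_space closed_csubspace_N_space closed_csubspace_UNIV proj_UNIV)

lemma closed_csubspace_range_P: "closed_csubspace (tensor_space (N_space J) (UNIV :: 'k set))"
  by (rule closed_csubspace_tensor_space[OF closed_csubspace_N_space closed_csubspace_UNIV])

lemma bounded_clinear_P: "bounded_clinear P"
  unfolding P_eq by (rule bounded_clinear_proj[OF closed_csubspace_range_P])

lemma P_P: "P (P x) = P x"
  unfolding P_eq by (rule proj_proj[OF closed_csubspace_range_P])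

lemma P_M: "x \<in> M \<Longrightarrow> P x = x"
  unfolding P_eq using M_subset by (intro proj_ident[OF closed_csubspace_range_P]) auto

text \<open>The orthogonal sum of \<open>M\<close> and the kernel $\mathcal M_J\otimes\mathcal K$ of \<open>P\<close>; it is invariant
  under the unconstrained operators $S_i\otimes I$.\<close>

definition lift_M :: "('n list, 'k) ell2 set" where
  "lift_M = {x. P x \<in> M}"

definition shifted_M :: "('n list, 'k) ell2 set" where
  "shifted_M = {y. ell2_nth y [] = 0} \<inter> (\<Inter>i. {y. lannih i y \<in> lift_M})"

definition wander :: "('n list, 'k) ell2 set" where
  "wander = lift_M \<inter> orth_compl shifted_M"

lemma closed_csubspace_lift_M: "closed_csubspace lift_M"
  unfolding lift_M_def by (rule closed_csubspace_vimage[OF bounded_clinear_P M])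

lemma closed_csubspace_shifted_M: "closed_csubspace shifted_M"
  unfolding shifted_M_def
  using closed_csubspace_vimage[OF bounded_clinear_ell2_nth closed_csubspace_zero]
  by (auto intro!: closed_csubspace_Int closed_csubspace_Inter
      closed_csubspace_vimage[OF bounded_clinear_lannih closed_csubspace_lift_M])

lemma lcreate_lift_M:
  assumes "x \<in> lift_M"
  shows "lcreate i x \<in> lift_M"
proof -
  note b = bounded_clinear_proj_N bounded_clinear_left_creation bounded_clinear_id(1)
    bounded_clinear_constr_left
  have "P (lcreate i y) = tensor_op (constr_left J i) id y" for y :: "('n list, 'k) ell2"
  proof -
    have "proj (N_space J) \<circ> left_creation i = constr_left J i"
      by (simp add: fun_eq_iff constr_left_def compression_def proj_N_left_creation[OF J])
    then show ?thesis
      by (simp add: tensor_op_compose b flip: tensor_op_left_creation)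
  qed
  moreover have "tensor_op (constr_left J i) id (P y) = tensor_op (constr_left J i) id y"
    for y :: "('n list, 'k) ell2"
  proof -
    have "constr_left J i \<circ> proj (N_space J) = constr_left J i"
      by (simp add: fun_eq_iff constr_left_def compression_def proj_proj closed_csubspace_N_space)
    then show ?thesis
      by (simp add: tensor_op_compose b)
  qed
  ultimately have "P (lcreate i x) = tensor_op (constr_left J i) id (P x)"
    by simp
  then show ?thesis
    using assms invariant by (auto simp: lift_M_def)
qed

lemma lcreate_shifted_M: "x \<in> lift_M \<Longrightarrow> lcreate i x \<in> shifted_M"
  by (auto simp: shifted_M_def lannih_lcreate closed_csubspace_0[OF closed_csubspace_lift_M])

lemma shifted_M_subset: "shifted_M \<subseteq> lift_M"
proof
  fix y assume y: "y \<in> shifted_M"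
  \<comment> \<open>A vector without vacuum component is reassembled from its parts by first letter;
    the alphabet is finite.\<close>
  have "y = (\<Sum>i\<in>UNIV. lcreate i (lannih i y))"
  proof (rule ell2_eqI)
    fix w
    show "ell2_nth y w = ell2_nth (\<Sum>i\<in>UNIV. lcreate i (lannih i y)) w"
      using y by (cases w) (auto simp: ell2_nth_sum shifted_M_def lannih.rep_eq)
  qed
  also have "\<dots> \<in> lift_M"
    using y by (intro closed_csubspace_sum closed_csubspace_lift_M lcreate_lift_M) (auto simp: shifted_M_def)
  finally show "y \<in> lift_M" .
qed

sublocale wandering_subspace lift_M wander
proof
  show "closed_csubspace lift_M"
    by (rule closed_csubspace_lift_M)
  show "closed_csubspace wander"
    unfolding wander_def
    by (intro closed_csubspace_Int closed_csubspace_lift_M closed_csubspace_orth_compl)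
  show "lcreate i x \<in> lift_M" if "x \<in> lift_M" for x i
    using that by (rule lcreate_lift_M)
  show "wander \<subseteq> lift_M"
    by (auto simp: wander_def)
  show "cinner (lcreate i x) g = 0" if "x \<in> lift_M" "g \<in> wander" for x g i
    using that(2) lcreate_shifted_M[OF that(1)] by (auto simp: wander_def orth_compl_def)
  fix y i assume y: "y \<in> lift_M" and orth: "\<And>g. g \<in> wander \<Longrightarrow> cinner g y = 0"
  \<comment> \<open>The remainder \<open>y - d\<close> is a wandering vector, hence orthogonal to
    \<open>y\<close> by assumption and to \<open>d\<close> by construction, so it is zero.\<close>
  define d where "d = proj shifted_M y"
  have d: "d \<in> shifted_M" "y - d \<in> orth_compl shifted_M"
    by (simp_all add: d_def proj_in proj_orth closed_csubspace_shifted_M)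
  then have "y - d \<in> wander"
    using y shifted_M_subset closed_csubspace_diff[OF closed_csubspace_lift_M] by (auto simp: wander_def)
  then have "cinner (y - d) y = 0"
    by (rule orth)
  moreover have "cinner (y - d) d = 0"
    using d by (auto simp: orth_compl_def cinner_eq_0_commute)
  ultimately have "cinner (y - d) (y - d) = 0"
    by (simp add: cinner_diff_right)
  then have "y \<in> shifted_M"
    using d(1) by simp
  then show "ell2_nth y [] = 0 \<and> lannih i y \<in> lift_M"
    by (auto simp: shifted_M_def)
qed

definition \<Theta> :: "('n list, ('n list, 'k) ell2) ell2 \<Rightarrow> ('n list, 'k) ell2" where
  "\<Theta> = P \<circ> V"

lemma bounded_clinear_\<Theta>: "bounded_clinear \<Theta>"
  unfolding \<Theta>_def by (rule bounded_clinear_compose[OF bounded_clinear_P bounded_clinear_V])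

text \<open>The subspace is kept abstract because it is instantiated twice: with the operators
  between the tensor spaces, and with each member of the family whose intersection is
  \<open>W_tensor_B\<close>.\<close>

lemma P_cesaro_in:
  assumes \<X>: "op_subspace \<X>"
    and gen: "\<And>A T. A \<in> W_alg J \<Longrightarrow> T \<in> bops wander UNIV \<Longrightarrow> tensor_op A T \<in> \<X>"
  shows "P \<circ> cesaro m \<in> \<X>"
proof -
  note b = bounded_clinear_proj_N bounded_clinear_rcreate_word bounded_clinear_id(1) bounded_clinear_symbol
  have "P (tensor_op (rcreate_word u) (symbol u) x) = tensor_op (compression (N_space J) (rcreate_word u)) (symbol u) x"
    for u x
  proof -
    have "proj (N_space J) \<circ> rcreate_word u = compression (N_space J) (rcreate_word u)"
      by (simp add: fun_eq_iff compression_def proj_N_rcreate_word[OF J])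
    then show ?thesis
      by (simp add: tensor_op_compose b)
  qed
  then have "P \<circ> cesaro m = (\<lambda>x. \<Sum>u | length u < m. complex_of_real (real (m - length u) / real m) *\<^sub>C
      tensor_op (compression (N_space J) (rcreate_word u)) (symbol u) x)"
    by (simp add: fun_eq_iff cesaro_def linear_sum[OF bounded_clinear_linear[OF bounded_clinear_P]]
        bounded_clinear_scaleC[OF bounded_clinear_P])
  also have "\<dots> \<in> \<X>"
    by (intro op_subspace_sum[OF \<X>] gen compression_rcreate_word_in_W_alg[OF J] symbol_in_bops)
  finally show ?thesis .
qed

lemma P_cesaro_weak_tendsto:
  "(\<lambda>m. cinner y ((P \<circ> cesaro (Suc m)) x)) \<longlonglongrightarrow> cinner y (\<Theta> x)"
  using cesaro_weak_tendsto[of "P y" x]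
  unfolding \<Theta>_def o_def P_eq proj_self_adjoint[OF closed_csubspace_range_P] .

lemma \<Theta>_in_bops: "\<Theta> \<in> bops (tensor_space (N_space J) wander) (tensor_space (N_space J) UNIV)"
proof -
  let ?B = "bops (tensor_space (N_space J) wander) (tensor_space (N_space J) (UNIV :: 'k set))"
  have "P \<circ> cesaro m \<in> ?B" for m
  proof (rule P_cesaro_in)
    show "op_subspace ?B"
      by (rule op_subspace_bops[OF closed_csubspace_range_P])
    show "tensor_op A T \<in> ?B" if "A \<in> W_alg J" "T \<in> bops wander UNIV" for A T
      using W_alg_intertwines[OF J that(1)]
      by (intro tensor_op_in_bops that(2) closed_csubspace_N_space closed_G closed_csubspace_UNIV) (auto simp: intertwiners_def)
  qed
  then have "\<Theta> x = 0" if "x \<in> orth_compl (tensor_space (N_space J) wander)" for x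
  proof -
    have "(P \<circ> cesaro m) x = 0" for m
      using \<open>P \<circ> cesaro m \<in> ?B\<close> that by (rule bops_orth)
    then have "cinner y (\<Theta> x) = cinner y 0" for y
      using P_cesaro_weak_tendsto[of y x] by (simp add: LIMSEQ_const_iff)
    then show ?thesis
      by (rule cinner_ext)
  qed
  moreover have "\<Theta> x \<in> tensor_space (N_space J) UNIV" for x
    unfolding \<Theta>_def P_eq by (simp add: proj_in closed_csubspace_range_P)
  ultimately show ?thesis
    using bounded_clinear_\<Theta> by (auto simp: bops_def)
qed

lemma \<Theta>_in_W_tensor_B: "\<Theta> \<in> W_tensor_B J wander UNIV"
  unfolding W_tensor_B_def hull_def
proof (safe, goal_cases)
  case (1 \<X>)
  show ?case
  proof (rule closedin_wot_sequentially[OF 1(3) _ \<Theta>_in_bops P_cesaro_weak_tendsto])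
    show "P \<circ> cesaro (Suc m) \<in> \<X>" for m
      using 1 by (intro P_cesaro_in) auto
  qed
qed

lemma \<Theta>_image: "\<Theta> ` tensor_space (N_space J) wander = M"
proof -
  have "P ` lift_M = M"
  proof
    show "M \<subseteq> P ` lift_M"
    proof
      fix x assume "x \<in> M"
      then show "x \<in> P ` lift_M"
        by (intro image_eqI[of x P x]) (simp_all add: lift_M_def P_M)
    qed
  qed (auto simp: lift_M_def)
  moreover have "range \<Theta> = P ` range V"
    by (auto simp: \<Theta>_def)
  moreover have "\<Theta> ` tensor_space (N_space J) wander = range \<Theta>"
  proof -
    note closed = closed_csubspace_tensor_space[OF closed_csubspace_N_space closed_G]
    have "\<Theta> x = \<Theta> (proj (tensor_space (N_space J) wander) x)" for x
      using bops_orth[OF \<Theta>_in_bops proj_orth[OF closed, of x]]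
      by (simp add: linear_diff[OF bounded_clinear_linear[OF bounded_clinear_\<Theta>]])
    then show ?thesis
      using proj_in[OF closed] by blast
  qed
  ultimately show ?thesis
    by (simp add: range_V)
qed

lemma partial_isometry_\<Theta>: "partial_isometry \<Theta>"
  unfolding partial_isometry_def
proof
  fix x assume x: "x \<in> orth_compl {x. \<Theta> x = 0}"
  note linV = bounded_clinear_linear[OF bounded_clinear_V]
  note linP = bounded_clinear_linear[OF bounded_clinear_P]
  have Q: "coefficient_proj = proj (tensor_space UNIV wander)"
    by (simp add: proj_tensor_space closed_csubspace_UNIV closed_G proj_UNIV)
  note closed_Q = closed_csubspace_tensor_space[OF closed_csubspace_UNIV closed_G]
  \<comment> \<open>The kernel of \<open>\<Theta>\<close> contains that of
    \<open>coefficient_proj\<close>, so \<open>x\<close> lies in the space on which \<open>V\<close>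
    is isometric. It remains to show that \<open>P\<close> fixes \<open>V x\<close>.\<close>
  have Qx: "coefficient_proj x = x"
  proof -
    have "\<Theta> (x - coefficient_proj x) = 0"
      by (simp add: \<Theta>_def linear_diff[OF linV] V_coefficient_proj linear_0[OF linP])
    then have "cinner (x - coefficient_proj x) x = 0"
      using x by (auto simp: orth_compl_def)
    moreover have "cinner (x - coefficient_proj x) (coefficient_proj x) = 0"
      unfolding Q using cinner_proj_orth[OF closed_Q proj_in[OF closed_Q]] by (simp add: cinner_eq_0_commute)
    ultimately have "cinner (x - coefficient_proj x) (x - coefficient_proj x) = 0"
      by (simp add: cinner_diff_right)
    then show ?thesis
      by simp
  qed
  have "P (V x - P (V x)) = 0"
    by (simp add: linear_diff[OF linP] P_P)
  \<comment> \<open>The defect is $Vz$ with \<open>z\<close> in the kernel of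
    \<open>\<Theta>\<close>. It is thus orthogonal to $Vx$ as well as to $PVx$, hence to
    itself.\<close>
  then have "V x - P (V x) \<in> range V"
    by (simp add: range_V lift_M_def closed_csubspace_0[OF M])
  then obtain z where z: "V x - P (V x) = V z"
    by blast
  then have "\<Theta> z = 0"
    using \<open>P (V x - P (V x)) = 0\<close> by (simp add: \<Theta>_def)
  then have "cinner z x = 0"
    using x by (auto simp: orth_compl_def)
  then have "cinner (V z) (V x) = 0"
    unfolding cinner_V Qx by (simp add: Q proj_self_adjoint[OF closed_Q, symmetric] Qx[unfolded Q])
  moreover have "cinner (V z) (P (V x)) = 0"
    unfolding z[symmetric] P_eq
    using cinner_proj_orth[OF closed_csubspace_range_P proj_in[OF closed_csubspace_range_P]]
    by (simp add: cinner_eq_0_commute)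
  ultimately have "cinner (V z) (V x - P (V x)) = 0"
    by (simp add: cinner_diff_right)
  then have "P (V x) = V x"
    unfolding z by (simp add: z[symmetric])
  then show "norm (\<Theta> x) = norm x"
    by (simp add: \<Theta>_def norm_V Qx)
qed

lemma ex_inner_operator:
  "\<exists>(G :: ('n list, 'k) ell2 set) \<Theta>. closed_csubspace G \<and> inner_operator J G UNIV \<Theta> \<and>
    M = \<Theta> ` tensor_space (N_space J) G"
  using closed_G \<Theta>_in_W_tensor_B partial_isometry_\<Theta> \<Theta>_image unfolding inner_operator_def by metis

end

theorem theorem1p2:
  fixes J :: "('n::finite fock \<Rightarrow> 'n fock) set"
    and M :: "('n list, 'k::chilbert_space) ell2 set"
  assumes "wot_closed_ideal J" and "J \<noteq> F_infty"
    and "closed_csubspace M" and "M \<subseteq> tensor_space (N_space J) UNIV"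
  shows "((\<forall>i. tensor_op (constr_left J i) id ` M \<subseteq> M) \<longleftrightarrow>
           (\<exists>(G :: ('n list, 'k) ell2 set) \<Theta>. closed_csubspace G \<and> inner_operator J G UNIV \<Theta> \<and>
              M = \<Theta> ` tensor_space (N_space J) G))
       \<and> ((\<exists>(G :: 'g::chilbert_space set) \<Theta>. closed_csubspace G \<and> inner_operator J G UNIV \<Theta> \<and>
              M = \<Theta> ` tensor_space (N_space J) G) \<longrightarrow>
           (\<forall>i. tensor_op (constr_left J i) id ` M \<subseteq> M))"
proof (intro conjI iffI impI allI)
  assume "\<forall>i. tensor_op (constr_left J i) id ` M \<subseteq> M"
  then interpret constrained_invariant_subspace J M
    using assms by unfold_locales auto
  show "\<exists>(G :: ('n list, 'k) ell2 set) \<Theta>. closed_csubspace G \<and> inner_operator J G UNIV \<Theta> \<and>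
      M = \<Theta> ` tensor_space (N_space J) G"
    by (rule ex_inner_operator)
next
  fix i
  assume "\<exists>(G :: ('n list, 'k) ell2 set) \<Theta>. closed_csubspace G \<and> inner_operator J G UNIV \<Theta> \<and>
      M = \<Theta> ` tensor_space (N_space J) G"
  then show "tensor_op (constr_left J i) id ` M \<subseteq> M"
    using inner_operator_image_invariant[OF assms(1)] by blast
next
  fix i
  assume "\<exists>(G :: 'g set) \<Theta>. closed_csubspace G \<and> inner_operator J G UNIV \<Theta> \<and>
      M = \<Theta> ` tensor_space (N_space J) G"
  then show "tensor_op (constr_left J i) id ` M \<subseteq> M"
    using inner_operator_image_invariant[OF assms(1)] by blast
qed

end
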